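(* For every $n\in\mathbb N$, the geometric realization $|\Delta(\mathsf T_n)|$ of the order complex of the poset $\mathsf T_n$ is Cohen–Macaulay over $\mathbb Z$ and homeomorphic to a ball of dimension $\binom{n+1}{2}-1$. The number of maximal chains of $\mathsf T_n$ (equivalently, facets of $\Delta(\mathsf T_n)$) is \[ \frac{\binom{n+1}{2}!\cdot\prod_{a=1}^{n-1}a!}{\prod_{b=1}^n(2b-1)!}. \]
   Context: For nonempty $A,B\subseteq[n]=\{1,\dots,n\}$ write $A\sqsubseteq B$ if there is a two-column semistandard Young tableau whose first column has entry set $A$ and whose second column has entry set $B$; equivalently $\#A\ge\#B$ and $A(k)\le B(k)$ for all $k\le\#B$, where $A(k)$ is the $k$-th smallest element of $A$. This is a partial order (the tableau order); $\mathsf T_n$ is the poset $(2^{[n]}\setminus\{\varnothing\},\sqsubseteq)$. The order complex $\Delta(P)$ of a finite poset $P$ is the simplicial complex whose simplices are the chains of $P$. *)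

theory Defs
  imports "HOL-Analysis.Analysis" "HOL-Homology.Homology"
begin

definition kth :: "nat set \<Rightarrow> nat \<Rightarrow> nat" where
  "kth A k = sorted_list_of_set A ! k"

definition tab_le :: "nat \<Rightarrow> nat set \<Rightarrow> nat set \<Rightarrow> bool" where
  "tab_le n A B \<longleftrightarrow> A \<subseteq> {1..n} \<and> B \<subseteq> {1..n} \<and> A \<noteq> {} \<and> B \<noteq> {} \<and>
     card B \<le> card A \<and> (\<forall>k < card B. kth A k \<le> kth B k)"

definition T :: "nat \<Rightarrow> nat set set" where
  "T n = {A. A \<subseteq> {1..n} \<and> A \<noteq> {}}"

definition order_complex :: "'a set \<Rightarrow> ('a \<Rightarrow> 'a \<Rightarrow> bool) \<Rightarrow> 'a set set" where
  "order_complex P rel = {C. finite C \<and> C \<subseteq> P \<and> (\<forall>x\<in>C. \<forall>y\<in>C. rel x y \<or> rel y x)}"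

definition maximal_chains :: "'a set \<Rightarrow> ('a \<Rightarrow> 'a \<Rightarrow> bool) \<Rightarrow> 'a set set" where
  "maximal_chains P rel = {C \<in> order_complex P rel. \<forall>D \<in> order_complex P rel. C \<subseteq> D \<longrightarrow> D = C}"

text \<open>Geometric realization of an abstract simplicial complex K (a set of finite vertex sets):
  points are barycentric-coordinate functions supported on a face of K, with the
  subspace topology of the product topology.\<close>
definition realization :: "'a set set \<Rightarrow> ('a \<Rightarrow> real) topology" where
  "realization K = subtopology (powertop_real UNIV)
     {f. \<exists>F\<in>K. (\<forall>x. f x \<ge> 0) \<and> (\<forall>x. x \<notin> F \<longrightarrow> f x = 0) \<and> sum f F = 1}"

definition sc_dim :: "'a set set \<Rightarrow> int" where
  "sc_dim K = int (Max (card ` K)) - 1"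

definition sc_link :: "'a set set \<Rightarrow> 'a set \<Rightarrow> 'a set set" where
  "sc_link K F = {G \<in> K. G \<inter> F = {} \<and> G \<union> F \<in> K}"

text \<open>Cohen-Macaulay over Z (Reisner's criterion): for every face F, the reduced (integral)
  homology of the link of F vanishes below the dimension of the link.\<close>
definition cohen_macaulay_Z :: "'a set set \<Rightarrow> bool" where
  "cohen_macaulay_Z K \<longleftrightarrow> (\<forall>F\<in>K. \<forall>i::int. i < sc_dim (sc_link K F) \<longrightarrow>
      trivial_group (reduced_homology_group i (realization (sc_link K F))))"

definition closed_ball_space :: "nat \<Rightarrow> (nat \<Rightarrow> real) topology" where
  "closed_ball_space d = subtopology (Euclidean_space d) {x. (\<Sum>i<d. x i ^ 2) \<le> 1}"

end

theory Submission
  imports Defs "HOL-Computational_Algebra.Polynomial"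
begin

text \<open>Via the counting functions \<open>t \<mapsto> |A \<inter> {1..t}|\<close>, the poset \<open>T n\<close> is anti-isomorphic to the lattice
  of order ideals of the shifted staircase with its first box removed. The order complex of the
  ideals of a finite poset \<open>Q\<close> triangulates the order polytope of \<open>Q\<close>: a chain-supported weight \<open>w\<close> is
  sent to the sum of \<open>w A\<close> times the indicator of the ideal \<open>A\<close>, and a point is recovered from its
  superlevel sets. The polytope is a convex body, hence a ball.

  A link of a face \<open>F\<close> missing the empty or the full ideal is a cone. Otherwise \<open>F\<close> cuts \<open>Q\<close> into
  blocks, and the same map modulo functions constant on blocks identifies the link with the unit
  vectors of the convex cone of functions that are order preserving on each block. If all blocks are
  antichains this is a sphere of the dimension of the link; otherwise the cone is not a linear
  subspace and its unit vectors contract to a strictly order-preserving function.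

  Maximal chains are counted by removing boxes from strict partitions. The product formula satisfies
  the recursion because, in the variable \<open>x (x - 1)\<close>, the latter says that the divided difference of
  a polynomial of degree less than the number of nodes is its top coefficient.\<close>

section \<open>Realizations, balls and spheres\<close>

text \<open>A homeomorphism out of a realization is obtained from a continuous bijection on a
  compact set, so what has to be proved is injectivity and surjectivity of a linear map, up to
  radial scaling. Both rest on one fact: a nonnegative combination of indicators of nested nonempty
  ideals is determined by its values, and the ideals that occur are superlevel sets. Links reduce to
  the same fact by lifting functions given modulo block constants.

  The first box of the staircase is omitted because a nonempty set has a positive count at
  \<open>n\<close>, so that every set would fill this box. Hence \<open>{n}\<close> is the empty
  ideal, \<open>{1..n}\<close> is the full one, and the dimension of the ball is one less than the
  number of boxes of the whole staircase.

  The variable x (x - 1) comes from shrinking a part x by one. For y different from x this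
  multiplies |x - y| / (x + y) by (x - 1 - y) (x + y) / ((x - y) (x + y - 1)), and with f z = z (z -
  1) that quotient is (f x - f (y + 1)) / (f x - f y).\<close>

definition geom :: "'a set set \<Rightarrow> ('a \<Rightarrow> real) set" where
  "geom K = {f. \<exists>F\<in>K. (\<forall>x. f x \<ge> 0) \<and> (\<forall>x. x \<notin> F \<longrightarrow> f x = 0) \<and> sum f F = 1}"

lemma realization_eq: "realization K = top_of_set (geom K)"
  by (simp add: realization_def geom_def euclidean_product_topology)

lemma homeomorphic_imp_homeomorphic_space:
  assumes "S homeomorphic V"
  shows "top_of_set S homeomorphic_space top_of_set V"
proof -
  obtain f g where "homeomorphism S V f g"
    using assms homeomorphic_def by blast
  then have "homeomorphic_maps (top_of_set S) (top_of_set V) f g"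
    by (auto simp: homeomorphism_def homeomorphic_maps_def continuous_map_in_subtopology image_subset_iff)
  then show ?thesis
    unfolding homeomorphic_space_def by blast
qed

text \<open>A finite union over the faces: on each face the points form a closed subset of a product
  of compact intervals, with coordinates off the face pinned to 0. This compactness spares the later
  bijections a proof that the inverse is continuous.\<close>

lemma compact_geom:
  assumes "finite K" "\<And>F. F \<in> K \<Longrightarrow> finite F"
  shows "compact (geom K)"
proof -
  have "compact {f::'a \<Rightarrow> real. (\<forall>x. f x \<ge> 0) \<and> (\<forall>x. x \<notin> F \<longrightarrow> f x = 0) \<and> sum f F = 1}"
    (is "compact ?A") if "F \<in> K" for F
  proof -
    have fin: "finite F" using assms that by blast
    have "compactin (powertop_real UNIV) (PiE UNIV (\<lambda>x. if x \<in> F then {0..1::real} else {0}))"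
      by (simp add: compactin_PiE)
    then have "compact (PiE UNIV (\<lambda>x. if x \<in> F then {0..1::real} else {0}))"
      by (simp add: euclidean_product_topology)
    moreover have "closed {f::'a \<Rightarrow> real. sum f F = 1}"
      by (intro closed_Collect_eq continuous_intros) auto
    moreover have "?A = PiE UNIV (\<lambda>x. if x \<in> F then {0..1::real} else {0}) \<inter> {f. sum f F = 1}"
    proof (intro Set.set_eqI iffI)
      fix f assume f: "f \<in> ?A"
      have "f x \<le> 1" if "x \<in> F" for x
        using member_le_sum[of x F f] f fin that by auto
      with f show "f \<in> PiE UNIV (\<lambda>x. if x \<in> F then {0..1::real} else {0}) \<inter> {f. sum f F = 1}"
        by auto
    next
      fix f assume f: "f \<in> PiE UNIV (\<lambda>x. if x \<in> F then {0..1::real} else {0}) \<inter> {f. sum f F = 1}"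
      then have "f x \<in> (if x \<in> F then {0..1::real} else {0})" for x
        using PiE_mem[of f UNIV "\<lambda>x. if x \<in> F then {0..1::real} else {0}" x] by blast
      then have "0 \<le> f x" "x \<notin> F \<longrightarrow> f x = 0" for x
        by (metis atLeastAtMost_iff order.refl singletonD, metis singletonD)
      with f show "f \<in> ?A" by auto
    qed
    ultimately show ?thesis
      by (simp add: compact_Int_closed)
  qed
  moreover have "geom K = (\<Union>F\<in>K. {f. (\<forall>x. f x \<ge> 0) \<and> (\<forall>x. x \<notin> F \<longrightarrow> f x = 0) \<and> sum f F = 1})"
    by (auto simp: geom_def)
  ultimately show ?thesis
    using assms(1) by (simp add: compact_UN)
qed

section \<open>Coordinate models of balls and spheres\<close>

lemma L2_set_reindex_bij_betw:
  "bij_betw e A S \<Longrightarrow> L2_set (\<lambda>i. x (e i)) A = L2_set x S"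
  unfolding L2_set_def using sum.reindex_bij_betw[of e A S "\<lambda>q. (x q)\<^sup>2"] by simp

text \<open>\<open>Pr\<close> stands for either the ball or the sphere condition on the
  norm.\<close>

lemma homeomorphic_reindex:
  fixes e :: "nat \<Rightarrow> 'q"
  assumes e: "bij_betw e {..<d} S"
  shows "{x. (\<forall>q. q \<notin> S \<longrightarrow> x q = (0::real)) \<and> Pr (L2_set x S)} homeomorphic
         {y. (\<forall>i\<ge>d. y i = (0::real)) \<and> Pr (L2_set y {..<d})}" (is "?A homeomorphic ?B")
proof -
  define f where "f = (\<lambda>x::'q \<Rightarrow> real. \<lambda>i. if i < d then x (e i) else 0)"
  define k where "k = inv_into {..<d} e"
  define g where "g = (\<lambda>y::nat \<Rightarrow> real. \<lambda>q. if q \<in> S then y (k q) else 0)"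
  have k: "bij_betw k S {..<d}"
    unfolding k_def by (rule bij_betw_inv_into[OF e])
  have ek: "e (k q) = q" if "q \<in> S" for q
    using that e unfolding k_def by (metis bij_betw_inv_into_right)
  have ke: "k (e i) = i" if "i < d" for i
    using that e unfolding k_def by (metis bij_betw_inv_into_left lessThan_iff)
  have kd: "k q < d" if "q \<in> S" for q
    using that k by (auto simp: bij_betw_def)
  have eS: "e i \<in> S" if "i < d" for i
    using that e by (auto simp: bij_betw_def)
  have Lf: "L2_set (f x) {..<d} = L2_set x S" for x
  proof -
    have "L2_set (f x) {..<d} = L2_set (\<lambda>i. x (e i)) {..<d}"
      by (rule L2_set_cong) (auto simp: f_def)
    then show ?thesis using L2_set_reindex_bij_betw[OF e] by metis
  qed
  have Lg: "L2_set (g y) S = L2_set y {..<d}" for y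
  proof -
    have "L2_set (g y) S = L2_set (\<lambda>q. y (k q)) S"
      by (rule L2_set_cong) (auto simp: g_def)
    then show ?thesis using L2_set_reindex_bij_betw[OF k] by metis
  qed
  have gf: "g (f x) = x" if "\<forall>q. q \<notin> S \<longrightarrow> x q = 0" for x
    using that by (auto simp: f_def g_def ek kd fun_eq_iff)
  have fg: "f (g y) = y" if "\<forall>i\<ge>d. y i = 0" for y
    using that by (auto simp: f_def g_def ke eS fun_eq_iff)
  have "homeomorphism ?A ?B f g"
  proof (rule homeomorphismI)
    show "continuous_on ?A f"
    proof (rule continuous_on_coordinatewise_then_product)
      show "continuous_on ?A (\<lambda>x. f x i)" for i
        by (cases "i < d") (auto simp: f_def intro: continuous_on_subset[OF continuous_on_product_coordinates])
    qed
    show "continuous_on ?B g"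
    proof (rule continuous_on_coordinatewise_then_product)
      show "continuous_on ?B (\<lambda>x. g x i)" for i
        by (cases "i \<in> S") (auto simp: g_def intro: continuous_on_subset[OF continuous_on_product_coordinates])
    qed
    show "f ` ?A \<subseteq> ?B" by (auto simp: Lf) (auto simp: f_def)
    show "g ` ?B \<subseteq> ?A" by (auto simp: Lg) (auto simp: g_def)
    show "\<And>x. x \<in> ?A \<Longrightarrow> g (f x) = x" using gf by auto
    show "\<And>y. y \<in> ?B \<Longrightarrow> f (g y) = y" using fg by auto
  qed
  then show ?thesis
    using homeomorphic_def by blast
qed

lemma closed_ball_space_eq:
  "closed_ball_space d = top_of_set {y. (\<forall>i\<ge>d. y i = 0) \<and> L2_set y {..<d} \<le> 1}"
proof -
  have "(\<Sum>i<d. (y i)\<^sup>2) \<le> 1 \<longleftrightarrow> L2_set y {..<d} \<le> 1" for y :: "nat \<Rightarrow> real"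
    by (simp add: L2_set_def)
  then show ?thesis
    unfolding closed_ball_space_def Euclidean_space_def
    by (simp add: subtopology_subtopology euclidean_product_topology Collect_conj_eq)
qed

text \<open>The last coordinate of \<open>nsphere d\<close> has index \<open>d\<close>, hence
  \<open>Suc d\<close> coordinates.\<close>

lemma nsphere_eq:
  "nsphere d = top_of_set {y. (\<forall>i\<ge>Suc d. y i = 0) \<and> L2_set y {..<Suc d} = 1}"
proof -
  have "(\<Sum>i\<le>d. (y i)\<^sup>2) = 1 \<longleftrightarrow> L2_set y {..<Suc d} = 1" for y :: "nat \<Rightarrow> real"
    by (simp add: L2_set_def lessThan_Suc_atMost)
  then show ?thesis
    unfolding nsphere_def Euclidean_space_def
    by (simp add: subtopology_subtopology euclidean_product_topology Collect_conj_eq)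
qed

lemma unit_sphere_homeomorphic_nsphere:
  assumes "finite S" "card S = Suc d"
  shows "top_of_set {x. (\<forall>q. q \<notin> S \<longrightarrow> x q = (0::real)) \<and> L2_set x S = 1}
           homeomorphic_space nsphere d"
proof -
  obtain e where "bij_betw e {..<Suc d} S"
    using assms by (metis ex_bij_betw_nat_finite lessThan_atLeast0)
  from homeomorphic_imp_homeomorphic_space[OF homeomorphic_reindex[OF this, of "\<lambda>t. t = 1"]]
  show ?thesis by (simp add: nsphere_eq)
qed

lemma unit_ball_homeomorphic_closed_ball_space:
  assumes "finite S" "card S = d"
  shows "top_of_set {x. (\<forall>q. q \<notin> S \<longrightarrow> x q = (0::real)) \<and> L2_set x S \<le> 1}
           homeomorphic_space closed_ball_space d"
proof -
  obtain e where "bij_betw e {..<d} S"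
    using assms by (metis ex_bij_betw_nat_finite lessThan_atLeast0)
  from homeomorphic_imp_homeomorphic_space[OF homeomorphic_reindex[OF this, of "\<lambda>t. t \<le> 1"]]
  show ?thesis by (simp add: closed_ball_space_eq)
qed

lemma continuous_on_L2_set:
  "continuous_on A (\<lambda>x::'q \<Rightarrow> real. L2_set x S)"
  unfolding L2_set_def
  by (intro continuous_intros continuous_on_subset[OF continuous_on_product_coordinates]) auto

lemma abs_le_L2_set:
  assumes "finite S" "q \<in> S"
  shows "\<bar>x q\<bar> \<le> L2_set x S"
  using member_le_L2_set[OF assms, of "\<lambda>q. \<bar>x q\<bar>"] by (simp add: L2_set_def)

lemma L2_set_scale:
  "0 \<le> t \<Longrightarrow> L2_set (\<lambda>q. t * x q) S = t * L2_set x S"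
  by (simp add: L2_set_right_distrib)

text \<open>Radial rescaling: the sublevel set of a gauge \<open>g\<close> is carried onto the Euclidean unit ball by
  \<open>x \<mapsto> (g x / |x|) x\<close>, which at the origin relies on \<open>0 / 0 = 0\<close>.\<close>

lemma gauge_ball_homeomorphic_unit_ball:
  fixes g :: "('q::countable \<Rightarrow> real) \<Rightarrow> real"
  assumes S: "finite S"
    and g: "continuous_on UNIV g"
    and hom: "\<And>t x. 0 \<le> t \<Longrightarrow> g (\<lambda>q. t * x q) = t * g x"
    and bound: "\<And>q x. q \<in> S \<Longrightarrow> \<bar>x q\<bar> \<le> g x"
    and nonneg: "\<And>x. 0 \<le> g x"
    and comp: "compact {x. (\<forall>q. q \<notin> S \<longrightarrow> x q = 0) \<and> g x \<le> 1}"
  shows "{x. (\<forall>q. q \<notin> S \<longrightarrow> x q = 0) \<and> g x \<le> 1} homeomorphic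
         {x. (\<forall>q. q \<notin> S \<longrightarrow> x q = 0) \<and> L2_set x S \<le> 1}" (is "?A homeomorphic ?B")
proof (rule homeomorphic_compact[OF comp])
  define N where "N = (\<lambda>x::'q \<Rightarrow> real. L2_set x S)"
  define f where "f = (\<lambda>x::'q \<Rightarrow> real. \<lambda>q. g x / N x * x q)"
  have N0: "N x = 0 \<longleftrightarrow> x = (\<lambda>_. 0)" if "\<forall>q. q \<notin> S \<longrightarrow> x q = 0" for x
    using that S by (auto simp: N_def L2_set_eq_0_iff fun_eq_iff)
  have Nn: "0 \<le> N x" for x by (simp add: N_def)
  have g0: "g (\<lambda>_. 0) = 0" using hom[of 0 "\<lambda>_. 0"] by simp
  have gpos: "0 < g x" if x: "\<forall>q. q \<notin> S \<longrightarrow> x q = 0" "x \<noteq> (\<lambda>_. 0)" for x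
  proof -
    obtain q where "x q \<noteq> 0" using x(2) by (auto simp: fun_eq_iff)
    moreover from this have "q \<in> S" using x(1) by blast
    ultimately show ?thesis using bound[of q x] by auto
  qed
  have Nscale: "N (\<lambda>q. t * x q) = t * N x" if "0 \<le> t" for t x
    unfolding N_def using that by (rule L2_set_scale)
  have Nf: "N (f x) = g x" if "\<forall>q. q \<notin> S \<longrightarrow> x q = 0" for x
  proof (cases "x = (\<lambda>_. 0)")
    case True then show ?thesis using N0 g0 by (simp add: f_def)
  next
    case False
    then have "N x \<noteq> 0" using N0 that by blast
    moreover have "N (f x) = g x / N x * N x"
      unfolding f_def by (rule Nscale) (simp add: Nn nonneg)
    ultimately show ?thesis by simp
  qed
  have fE: "\<forall>q. q \<notin> S \<longrightarrow> f x q = 0" if "\<forall>q. q \<notin> S \<longrightarrow> x q = 0" for x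
    using that by (simp add: f_def)
  show "continuous_on ?A f"
  proof (rule continuous_on_coordinatewise_then_product)
    fix q
    show "continuous_on ?A (\<lambda>x. f x q)"
    proof (cases "q \<in> S")
      case False
      then have "\<And>x. x \<in> ?A \<Longrightarrow> f x q = 0" using fE by blast
      then show ?thesis by (subst continuous_on_cong[OF refl]) auto
    next
      case q: True
      show ?thesis
        unfolding continuous_on_eq_continuous_within
      proof
        fix x assume x: "x \<in> ?A"
        show "continuous (at x within ?A) (\<lambda>x. f x q)"
        proof (cases "x = (\<lambda>_. 0)")
          case False
          then have "N x \<noteq> 0" using N0 x by blast
          have c1: "continuous (at x within ?A) g"
            using g by (meson UNIV_I continuous_on_eq_continuous_within continuous_within_subset subset_UNIV)
          have c2: "continuous (at x within ?A) N"
            using continuous_on_L2_set[of UNIV S] unfolding N_def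
            by (meson UNIV_I continuous_on_eq_continuous_within continuous_within_subset subset_UNIV)
          have "continuous_on UNIV (\<lambda>x::'q \<Rightarrow> real. x q)"
            by simp
          then have c3: "continuous (at x within ?A) (\<lambda>x. x q)"
            by (meson UNIV_I continuous_on_eq_continuous_within continuous_within_subset subset_UNIV)
          show ?thesis
            using c1 c2 c3 \<open>N x \<noteq> 0\<close> unfolding f_def continuous_within
            by (intro tendsto_mult tendsto_divide) auto
        next
          case True
          \<comment> \<open>The factor \<open>g y / N y\<close> need not converge at the origin. But
            the norm of \<open>f y\<close> is \<open>g y\<close>, so each coordinate is squeezed to
            0.\<close>
          have le: "\<bar>f y q\<bar> \<le> g y" if "y \<in> ?A" for y
            using abs_le_L2_set[OF S q, of "f y"] Nf[of y] that by (simp add: N_def)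
          have "(g \<longlongrightarrow> g x) (at x within ?A)"
            using g by (meson UNIV_I continuous_on_def tendsto_within_subset subset_UNIV)
          then have "(g \<longlongrightarrow> 0) (at x within ?A)" using True g0 by simp
          then have "((\<lambda>y. f y q) \<longlongrightarrow> 0) (at x within ?A)"
            by (rule Lim_null_comparison[rotated]) (auto simp: eventually_at_filter le intro!: always_eventually)
          then show ?thesis
            using True by (simp add: continuous_within f_def)
        qed
      qed
    qed
  qed
  show "inj_on f ?A"
  proof (rule inj_onI)
    fix x y assume x: "x \<in> ?A" and y: "y \<in> ?A" and eq: "f x = f y"
    have "g x = N (f x)" "g y = N (f y)" using Nf x y by simp_all
    then have gg: "g x = g y" using eq by simp
    show "x = y"
    proof (cases "x = (\<lambda>_. 0) \<or> y = (\<lambda>_. 0)")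
      case True
      have "g x = 0" "g y = 0" using True g0 gg by auto
      then have "x = (\<lambda>_. 0)" "y = (\<lambda>_. 0)" using gpos[of x] gpos[of y] x y by auto
      then show ?thesis by simp
    next
      case False
      then have p: "0 < g x" "0 < g y" "N x \<noteq> 0" "N y \<noteq> 0" using gpos N0 x y by auto
      then have Np: "0 < N x" "0 < N y" using Nn by (metis less_eq_real_def)+
      \<comment> \<open>Equal images lie on one ray; homogeneity of \<open>g\<close> then forces the
        ratio to be 1.\<close>
      define t where "t = N x / N y"
      have e: "g x / N x * x q = g x / N y * y q" for q
        using fun_cong[OF eq, of q] gg by (simp add: f_def)
      have "x q = t * y q" for q
        using e[of q] p Np by (simp add: t_def field_simps)
      then have "x = (\<lambda>q. t * y q)" by auto
      then have "g x = t * g y" using hom[of t y] Nn by (simp add: t_def)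
      then have "t = 1" using gg p by simp
      then show ?thesis using \<open>x = (\<lambda>q. t * y q)\<close> by simp
    qed
  qed
  show "f ` ?A = ?B"
  proof (intro subset_antisym subsetI)
    fix y assume "y \<in> f ` ?A"
    then obtain x where x: "x \<in> ?A" "y = f x" by blast
    then show "y \<in> ?B" using Nf[of x] fE[of x] unfolding N_def by simp
  next
    fix y assume y: "y \<in> ?B"
    show "y \<in> f ` ?A"
    proof (cases "y = (\<lambda>_. 0)")
      case True
      then have "y = f (\<lambda>_. 0)" by (simp add: f_def)
      then show ?thesis using g0 by force
    next
      case False
      then have p: "0 < g y" "0 < N y" using gpos N0 y Nn by (auto simp: less_le)
      \<comment> \<open>\<open>f x\<close> has norm \<open>g x\<close>, so the preimage of
        \<open>y\<close> is the point of its ray with gauge \<open>N y\<close>.\<close>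
      define t where "t = N y / g y"
      define x where "x = (\<lambda>q. t * y q)"
      have t: "0 < t" using p by (simp add: t_def)
      have "g x = t * g y" "N x = t * N y" unfolding x_def using hom Nscale t by (simp_all add: less_imp_le)
      then have "f x = y" using p t by (auto simp: f_def x_def t_def fun_eq_iff)
      moreover have "g x \<le> 1" using \<open>g x = t * g y\<close> y p by (simp add: t_def N_def)
      moreover have "\<forall>q. q \<notin> S \<longrightarrow> x q = 0" using y by (simp add: x_def)
      ultimately show ?thesis by blast
    qed
  qed
qed

section \<open>Order complexes of ideal lattices\<close>

text \<open>As the complex is closed under subsets, the support itself can serve as the witnessing
  face, and the mass may be summed over all vertices.\<close>

lemma geom_iff:
  assumes "finite P" "\<And>F. F \<in> L \<Longrightarrow> F \<subseteq> P" "\<And>F G. F \<in> L \<Longrightarrow> G \<subseteq> F \<Longrightarrow> G \<in> L"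
  shows "f \<in> geom L \<longleftrightarrow> (\<forall>x. 0 \<le> f x) \<and> {x. f x \<noteq> 0} \<in> L \<and> sum f P = 1"
proof
  assume "f \<in> geom L"
  then obtain F where F: "F \<in> L" "\<forall>x. 0 \<le> f x" "\<forall>x. x \<notin> F \<longrightarrow> f x = 0" "sum f F = 1"
    unfolding geom_def by blast
  then have "sum f P = 1"
    using sum.mono_neutral_left[OF assms(1) assms(2)[OF F(1)], of f] by auto
  moreover have "{x. f x \<noteq> 0} \<in> L"
  proof (rule assms(3)[OF F(1)])
    show "{x. f x \<noteq> 0} \<subseteq> F" using F(3) by blast
  qed
  ultimately show "(\<forall>x. 0 \<le> f x) \<and> {x. f x \<noteq> 0} \<in> L \<and> sum f P = 1"
    using F(2) by simp
next
  assume f: "(\<forall>x. 0 \<le> f x) \<and> {x. f x \<noteq> 0} \<in> L \<and> sum f P = 1"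
  then have "{x. f x \<noteq> 0} \<subseteq> P" by (intro assms(2)) simp
  then have "sum f {x. f x \<noteq> 0} = sum f P"
    by (intro sum.mono_neutral_left[OF assms(1)]) simp_all
  with f show "f \<in> geom L"
    unfolding geom_def by (intro CollectI bexI[of _ "{x. f x \<noteq> 0}"]) auto
qed

text \<open>An edge \<open>(p, q)\<close> says that an ideal containing \<open>q\<close> contains
  \<open>p\<close>; \<open>E\<close> only generates the order. The rank \<open>r\<close> excludes
  cycles and supplies strictly monotone functions: an interior point of the polytope and the centre
  of a contraction. \<open>rel\<close> is reverse inclusion of labels, as for the tableau
  order.\<close>

locale ideal_labelling =
  fixes Q :: "'q::countable set" and E :: "('q \<times> 'q) set" and r :: "'q \<Rightarrow> nat"
    and P :: "'a set" and rel :: "'a \<Rightarrow> 'a \<Rightarrow> bool" and lab :: "'a \<Rightarrow> 'q set"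
  assumes finite_Q: "finite Q" and E_subset: "E \<subseteq> Q \<times> Q"
    and rank_less: "(p, q) \<in> E \<Longrightarrow> r p < r q"
    and bij_lab: "bij_betw lab P {I. I \<subseteq> Q \<and> (\<forall>(p, q)\<in>E. q \<in> I \<longrightarrow> p \<in> I)}"
    and rel_iff: "A \<in> P \<Longrightarrow> B \<in> P \<Longrightarrow> rel A B \<longleftrightarrow> lab B \<subseteq> lab A"
begin

abbreviation K :: "'a set set" where
  "K \<equiv> order_complex P rel"

definition vec :: "('a \<Rightarrow> real) \<Rightarrow> 'q \<Rightarrow> real" where
  "vec w q = (\<Sum>A | A \<in> P \<and> q \<in> lab A. w A)"

definition chain_weight :: "('a \<Rightarrow> real) \<Rightarrow> bool" where
  "chain_weight w \<longleftrightarrow> (\<forall>A. 0 \<le> w A) \<and> {A. w A \<noteq> 0} \<in> K"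

text \<open>The direction is that of indicators of ideals: superlevel sets of such functions are
  closed under \<open>E\<close>.\<close>

definition E_mono :: "('q \<Rightarrow> real) \<Rightarrow> bool" where
  "E_mono x \<longleftrightarrow> (\<forall>(p, q)\<in>E. x q \<le> x p)"

lemma finite_P: "finite P"
proof -
  have "finite {I. I \<subseteq> Q \<and> (\<forall>(p, q)\<in>E. q \<in> I \<longrightarrow> p \<in> I)}"
    using finite_Q by simp
  then show ?thesis using bij_lab bij_betw_finite by blast
qed

lemma finite_E: "finite E"
  using finite_Q E_subset finite_subset by blast

lemma lab_subset: "A \<in> P \<Longrightarrow> lab A \<subseteq> Q"
  using bij_lab by (auto simp: bij_betw_def)

lemma lab_closed: "A \<in> P \<Longrightarrow> (p, q) \<in> E \<Longrightarrow> q \<in> lab A \<Longrightarrow> p \<in> lab A"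
  using bij_betw_apply[OF bij_lab] by fastforce

lemma lab_inject: "A \<in> P \<Longrightarrow> B \<in> P \<Longrightarrow> lab A = lab B \<Longrightarrow> A = B"
  using bij_lab by (auto simp: bij_betw_def inj_on_def)

lemma ex_lab:
  assumes "I \<subseteq> Q" "\<And>p q. (p, q) \<in> E \<Longrightarrow> q \<in> I \<Longrightarrow> p \<in> I"
  obtains A where "A \<in> P" "lab A = I"
proof -
  have "I \<in> lab ` P"
    using bij_lab assms by (auto simp: bij_betw_def)
  then show ?thesis using that by blast
qed

lemma K_iff: "C \<in> K \<longleftrightarrow> C \<subseteq> P \<and> (\<forall>A\<in>C. \<forall>B\<in>C. lab A \<subseteq> lab B \<or> lab B \<subseteq> lab A)"
proof -
  have "(rel A B \<or> rel B A) = (lab A \<subseteq> lab B \<or> lab B \<subseteq> lab A)" if "C \<subseteq> P" "A \<in> C" "B \<in> C" for A B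
    using that rel_iff by blast
  then show ?thesis
    unfolding order_complex_def using finite_subset[OF _ finite_P]
    by (simp cong: conj_cong ball_cong) blast
qed

lemma K_subset: "C \<in> K \<Longrightarrow> D \<subseteq> C \<Longrightarrow> D \<in> K"
  unfolding K_iff by blast

lemma geom_K_iff: "f \<in> geom K \<longleftrightarrow> chain_weight f \<and> sum f P = 1"
  unfolding chain_weight_def
  using geom_iff[OF finite_P, of K f] K_iff K_subset by blast

lemma finite_K: "finite K"
  by (rule finite_subset[of _ "Pow P"]) (auto simp: K_iff finite_P)

lemma compact_geom_K: "compact (geom K)"
  by (rule compact_geom[OF finite_K]) (use finite_P finite_subset in \<open>auto simp: K_iff\<close>)

lemma chain_weight_outside: "chain_weight w \<Longrightarrow> A \<notin> P \<Longrightarrow> w A = 0"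
  unfolding chain_weight_def K_iff by blast

lemma vec_outside: "q \<notin> Q \<Longrightarrow> vec w q = 0"
  unfolding vec_def using lab_subset by (intro sum.neutral) blast

lemma vec_add: "vec (\<lambda>A. v A + w A) q = vec v q + vec w q"
  by (simp add: vec_def sum.distrib)

lemma vec_diff: "vec (\<lambda>A. v A - w A) q = vec v q - vec w q"
  by (simp add: vec_def sum_subtractf)

lemma vec_scale: "vec (\<lambda>A. t * w A) q = t * vec w q"
  by (simp add: vec_def sum_distrib_left)

lemma vec_zero: "vec (\<lambda>_. 0) q = 0"
  by (simp add: vec_def)

lemma vec_single:
  assumes "B \<in> P"
  shows "vec (\<lambda>A. if A = B then m else 0) q = (if q \<in> lab B then m else 0)"
  unfolding vec_def using assms finite_P by simp

lemma vec_nonneg: "(\<And>A. 0 \<le> w A) \<Longrightarrow> 0 \<le> vec w q"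
  unfolding vec_def by (simp add: sum_nonneg)

lemma le_vec: "(\<And>A. 0 \<le> w A) \<Longrightarrow> A \<in> P \<Longrightarrow> q \<in> lab A \<Longrightarrow> w A \<le> vec w q"
  unfolding vec_def using finite_P by (intro member_le_sum) auto

lemma vec_mono:
  assumes "\<And>A. 0 \<le> w A" "\<And>A. A \<in> P \<Longrightarrow> w A \<noteq> 0 \<Longrightarrow> q \<in> lab A \<Longrightarrow> p \<in> lab A"
  shows "vec w q \<le> vec w p"
proof -
  have "vec w q = (\<Sum>A | A \<in> P \<and> q \<in> lab A \<and> w A \<noteq> 0. w A)"
    unfolding vec_def using finite_P by (intro sum.mono_neutral_right) auto
  also have "\<dots> \<le> vec w p"
    unfolding vec_def using finite_P assms by (intro sum_mono2) auto
  finally show ?thesis .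
qed

lemma E_mono_vec: "(\<And>A. 0 \<le> w A) \<Longrightarrow> E_mono (vec w)"
  unfolding E_mono_def using lab_closed by (auto intro!: vec_mono)

lemma continuous_on_vec: "continuous_on A (\<lambda>w. vec w q)"
  unfolding vec_def
  by (intro continuous_intros continuous_on_subset[OF continuous_on_product_coordinates]) auto

section \<open>Functions as combinations of nested ideals\<close>

lemma superlevel_chain:
  assumes "\<And>A. A \<in> C \<Longrightarrow> A \<in> P \<and> (\<exists>s. lab A = {q. s \<le> (x q :: real)})"
  shows "C \<in> K"
  unfolding K_iff
proof (intro conjI ballI)
  show "C \<subseteq> P" using assms by blast
next
  fix A B assume "A \<in> C" "B \<in> C"
  then obtain s t where "lab A = {q. s \<le> x q}" "lab B = {q. t \<le> x q}"
    using assms by meson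
  then show "lab A \<subseteq> lab B \<or> lab B \<subseteq> lab A"
    by (cases "s \<le> t") auto
qed

text \<open>Greedy peeling by induction on the support: the support is an ideal, and subtracting the
  least positive value times its indicator leaves a monotone function of smaller support. Recording
  the members as superlevel sets, and not merely as a chain, allows comparing them later with the
  ideals of a given face.\<close>

lemma ex_decomposition:
  assumes "\<And>q. 0 \<le> x q" "\<And>q. q \<notin> Q \<Longrightarrow> x q = 0" "E_mono x"
  shows "\<exists>w. (\<forall>A. 0 \<le> w A) \<and>
    (\<forall>A. w A \<noteq> 0 \<longrightarrow> A \<in> P \<and> lab A \<noteq> {} \<and> (\<exists>s>0. lab A = {q. s \<le> x q})) \<and> vec w = x"
  using assms
proof (induction "card {q. x q \<noteq> 0}" arbitrary: x rule: less_induct)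
  case less
  define I where "I = {q. x q \<noteq> 0}"
  have I: "I \<subseteq> Q" using less.prems(2) unfolding I_def by blast
  then have finI: "finite I" using finite_Q finite_subset by blast
  show ?case
  proof (cases "I = {}")
    case True
    then have "vec (\<lambda>_. 0) = x" by (auto simp: I_def vec_def fun_eq_iff)
    then show ?thesis by (intro exI[of _ "\<lambda>_. 0"]) auto
  next
    case False
    define m where "m = Min (x ` I)"
    have m_le: "m \<le> x q" if "q \<in> I" for q
      unfolding m_def using finI that by simp
    have "m \<in> x ` I" unfolding m_def using finI False by (intro Min_in) auto
    then obtain q0 where q0: "q0 \<in> I" "x q0 = m" by blast
    then have m: "0 < m" using less.prems(1)[of q0] by (auto simp: I_def)
    have I_eq: "I = {q. m \<le> x q}" using m_le m unfolding I_def by force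
    have down: "p \<in> I" if "(p, q) \<in> E" "q \<in> I" for p q
      using less.prems(3) that unfolding I_eq E_mono_def by fastforce
    then obtain A0 where A0: "A0 \<in> P" "lab A0 = I"
      using ex_lab I by metis
    define y where "y = (\<lambda>q. if q \<in> I then x q - m else 0)"
    have "{q. y q \<noteq> 0} \<subset> {q. x q \<noteq> 0}"
    proof
      show "{q. y q \<noteq> 0} \<subseteq> {q. x q \<noteq> 0}" by (auto simp: y_def I_def)
      have "q0 \<in> {q. x q \<noteq> 0}" "q0 \<notin> {q. y q \<noteq> 0}" using q0 by (auto simp: y_def I_def)
      then show "{q. y q \<noteq> 0} \<noteq> {q. x q \<noteq> 0}" by blast
    qed
    then have "card {q. y q \<noteq> 0} < card {q. x q \<noteq> 0}"
      using finI unfolding I_def by (rule psubset_card_mono[rotated])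
    moreover have "\<And>q. 0 \<le> y q" by (simp add: y_def m_le)
    moreover have "\<And>q. q \<notin> Q \<Longrightarrow> y q = 0" using I by (auto simp: y_def)
    moreover have "E_mono y"
      using less.prems(3) down m_le unfolding E_mono_def y_def by fastforce
    ultimately obtain w where w: "\<And>A. 0 \<le> w A" "vec w = y"
      "\<And>A. w A \<noteq> 0 \<Longrightarrow> A \<in> P \<and> lab A \<noteq> {} \<and> (\<exists>s>0. lab A = {q. s \<le> y q})"
      using less.hyps by blast
    define v where "v = (\<lambda>A. w A + (if A = A0 then m else 0))"
    have "vec v = x"
    proof
      fix q
      have "vec v q = y q + (if q \<in> I then m else 0)"
        unfolding v_def vec_add using vec_single[OF A0(1)] A0(2) w(2) by simp
      then show "vec v q = x q" by (auto simp: y_def I_def)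
    qed
    moreover have "A \<in> P \<and> lab A \<noteq> {} \<and> (\<exists>s>0. lab A = {q. s \<le> x q})" if "v A \<noteq> 0" for A
    proof (cases "A = A0")
      case True
      then show ?thesis using A0 False m I_eq by blast
    next
      case False
      then have "w A \<noteq> 0" using that by (simp add: v_def)
      then obtain s where s: "A \<in> P" "lab A \<noteq> {}" "s > 0" "lab A = {q. s \<le> y q}"
        using w(3) by blast
      \<comment> \<open>Positivity of \<open>s\<close> matters: outside \<open>I\<close> both sides
        are false, and inside \<open>I\<close> the thresholds differ by \<open>m\<close>.\<close>
      have "s \<le> y q \<longleftrightarrow> s + m \<le> x q" for q
        using s(3) m unfolding y_def I_eq by auto
      then have "lab A = {q. s + m \<le> x q}" using s(4) by simp
      then show ?thesis using s m by (intro conjI exI[of _ "s + m"]) auto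
    qed
    moreover have "\<forall>A. 0 \<le> v A" using w(1) m by (simp add: v_def)
    ultimately show ?thesis by blast
  qed
qed

lemma chain_weight_top:
  assumes "chain_weight w" "w B \<noteq> 0"
  obtains A where "A \<in> P" "w A \<noteq> 0" "\<And>B. w B \<noteq> 0 \<Longrightarrow> lab B \<subseteq> lab A"
proof -
  have C: "{A. w A \<noteq> 0} \<in> K" using assms(1) by (simp add: chain_weight_def)
  then have "finite (lab ` {A. w A \<noteq> 0})" using finite_P finite_subset by (auto simp: K_iff)
  from finite_has_maximal[OF this] obtain A where A: "w A \<noteq> 0"
    "\<And>B. w B \<noteq> 0 \<Longrightarrow> lab A \<subseteq> lab B \<Longrightarrow> lab A = lab B"
    using assms(2) by auto
  have "lab B \<subseteq> lab A" if "w B \<noteq> 0" for B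
    using C A that unfolding K_iff by blast
  then show ?thesis using that A C unfolding K_iff by blast
qed

lemma chain_weight_bot:
  assumes "chain_weight w" "w B \<noteq> 0"
  obtains A where "A \<in> P" "w A \<noteq> 0" "\<And>B. w B \<noteq> 0 \<Longrightarrow> lab A \<subseteq> lab B"
proof -
  have C: "{A. w A \<noteq> 0} \<in> K" using assms(1) by (simp add: chain_weight_def)
  then have "finite (lab ` {A. w A \<noteq> 0})" using finite_P finite_subset by (auto simp: K_iff)
  from finite_has_minimal[OF this] obtain A where A: "w A \<noteq> 0"
    "\<And>B. w B \<noteq> 0 \<Longrightarrow> lab B \<subseteq> lab A \<Longrightarrow> lab A = lab B"
    using assms(2) by auto
  have "lab A \<subseteq> lab B" if "w B \<noteq> 0" for B
    using C A that unfolding K_iff by blast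
  then show ?thesis using that A C unfolding K_iff by blast
qed

text \<open>The largest ideal of the chain can be read off from \<open>vec w\<close>, so nonzero
  weights with the same \<open>vec\<close> share their top member.\<close>

lemma chain_weight_top_support:
  assumes "chain_weight w" "w B \<noteq> 0"
  obtains A where "A \<in> P" "w A \<noteq> 0" "lab A = {q. vec w q \<noteq> 0}"
proof -
  obtain A where A: "A \<in> P" "w A \<noteq> 0" "\<And>B. w B \<noteq> 0 \<Longrightarrow> lab B \<subseteq> lab A"
    using chain_weight_top[OF assms] by blast
  have nonneg: "\<And>A. 0 \<le> w A" using assms by (simp add: chain_weight_def)
  have "vec w q \<noteq> 0" if "q \<in> lab A" for q
    using le_vec[of w A q] nonneg A that by (metis less_eq_real_def not_le)
  moreover have "vec w q = 0" if "q \<notin> lab A" for q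
    unfolding vec_def using A that by (intro sum.neutral) blast
  ultimately have "lab A = {q. vec w q \<noteq> 0}" by auto
  then show ?thesis using that A by blast
qed

lemma chain_weight_le:
  assumes "chain_weight w" "\<And>A. 0 \<le> v A" "\<And>A. v A \<noteq> 0 \<Longrightarrow> w A \<noteq> 0"
  shows "chain_weight v"
  using assms K_subset[of "{A. w A \<noteq> 0}" "{A. v A \<noteq> 0}"] unfolding chain_weight_def by blast

text \<open>Both weights have the same top ideal; subtracting a common amount there makes one
  support smaller. The empty ideal is excluded because its weight does not influence
  \<open>vec\<close>.\<close>

lemma decomposition_unique:
  assumes "chain_weight w" "chain_weight w'" "vec w = vec w'"
    "\<And>A. w A \<noteq> 0 \<Longrightarrow> lab A \<noteq> {}" "\<And>A. w' A \<noteq> 0 \<Longrightarrow> lab A \<noteq> {}"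
  shows "w = w'"
  using assms
proof (induction "card {A. w A \<noteq> 0} + card {A. w' A \<noteq> 0}" arbitrary: w w' rule: less_induct)
  case less
  have zero: "v = (\<lambda>_. 0)"
    if "chain_weight v" "vec v = vec (\<lambda>_. 0)" "\<And>A. v A \<noteq> 0 \<Longrightarrow> lab A \<noteq> {}" for v
  proof
    fix B
    show "v B = 0"
    proof (rule ccontr)
      assume "v B \<noteq> 0"
      from chain_weight_top_support[OF that(1) this] obtain A
        where A: "v A \<noteq> 0" "lab A = {q. vec v q \<noteq> 0}" by blast
      then show False using that(3)[OF A(1)] that(2) by (simp add: vec_zero)
    qed
  qed
  show ?case
  proof (cases "w = (\<lambda>_. 0) \<or> w' = (\<lambda>_. 0)")
    case True
    then have "vec w = vec (\<lambda>_. 0)" using less.prems(3) by auto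
    then have "w = (\<lambda>_. 0)" "w' = (\<lambda>_. 0)"
      using zero[of w] zero[of w'] less.prems by auto
    then show ?thesis by simp
  next
    case False
    then obtain B B' where B: "w B \<noteq> 0" "w' B' \<noteq> 0" by (auto simp: fun_eq_iff)
    obtain A where A: "A \<in> P" "w A \<noteq> 0" "lab A = {q. vec w q \<noteq> 0}"
      by (rule chain_weight_top_support[OF less.prems(1) B(1)])
    obtain A' where A': "A' \<in> P" "w' A' \<noteq> 0" "lab A' = {q. vec w' q \<noteq> 0}"
      by (rule chain_weight_top_support[OF less.prems(2) B(2)])
    have "A' = A" using lab_inject[OF A'(1) A(1)] A(3) A'(3) less.prems(3) by simp
    have nn: "0 \<le> w A" "0 \<le> w' A" "\<And>A. 0 \<le> w A" "\<And>A. 0 \<le> w' A"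
      using less.prems by (auto simp: chain_weight_def)
    \<comment> \<open>The minimum keeps both differences nonnegative and makes one of them vanish at
      \<open>A\<close>.\<close>
    define m where "m = min (w A) (w' A)"
    have m: "0 < m" using nn A A' \<open>A' = A\<close> by (simp add: m_def less_le)
    define \<delta> where "\<delta> = (\<lambda>B. if B = A then m else 0)"
    define v v' where "v = (\<lambda>B. w B - \<delta> B)" and "v' = (\<lambda>B. w' B - \<delta> B)"
    have sub: "{B. v B \<noteq> 0} \<subseteq> {B. w B \<noteq> 0}" "{B. v' B \<noteq> 0} \<subseteq> {B. w' B \<noteq> 0}"
      using A A' \<open>A' = A\<close> by (auto simp: v_def v'_def \<delta>_def)
    have fin: "finite {B. w B \<noteq> 0}" "finite {B. w' B \<noteq> 0}"
      using less.prems finite_P finite_subset unfolding chain_weight_def K_iff by blast+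
    have "v A = 0 \<or> v' A = 0" by (auto simp: v_def v'_def \<delta>_def m_def)
    then have "{B. v B \<noteq> 0} \<subset> {B. w B \<noteq> 0} \<or> {B. v' B \<noteq> 0} \<subset> {B. w' B \<noteq> 0}"
      using sub A(2) A'(2) \<open>A' = A\<close> by blast
    then have "card {B. v B \<noteq> 0} + card {B. v' B \<noteq> 0} < card {B. w B \<noteq> 0} + card {B. w' B \<noteq> 0}"
      using fin sub by (meson add_le_less_mono add_less_le_mono card_mono psubset_card_mono)
    moreover have "chain_weight v"
      using less.prems(1) by (rule chain_weight_le) (use nn sub in \<open>auto simp: v_def \<delta>_def m_def\<close>)
    moreover have "chain_weight v'"
      using less.prems(2) by (rule chain_weight_le) (use nn sub in \<open>auto simp: v'_def \<delta>_def m_def\<close>)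
    moreover have "vec v = vec v'"
      unfolding v_def v'_def using less.prems(3) by (auto simp: vec_diff fun_eq_iff)
    moreover have "\<And>A. v A \<noteq> 0 \<Longrightarrow> lab A \<noteq> {}" "\<And>A. v' A \<noteq> 0 \<Longrightarrow> lab A \<noteq> {}"
      using sub less.prems by blast+
    ultimately have "v = v'" using less.hyps by blast
    then show ?thesis by (auto simp: v_def v'_def fun_eq_iff)
  qed
qed

text \<open>A point of the smallest ideal of the chain lies in all of them, and there
  \<open>vec w\<close> equals the total mass.\<close>

lemma sum_le_of_vec_le:
  assumes "chain_weight w" "\<And>A. w A \<noteq> 0 \<Longrightarrow> lab A \<noteq> {}" "\<And>q. vec w q \<le> c" "0 \<le> c"
  shows "sum w P \<le> c"
proof (cases "\<exists>B. w B \<noteq> 0")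
  case False
  then show ?thesis using assms by simp
next
  case True
  then obtain A where A: "A \<in> P" "w A \<noteq> 0" "\<And>B. w B \<noteq> 0 \<Longrightarrow> lab A \<subseteq> lab B"
    using chain_weight_bot[OF assms(1)] by metis
  obtain q where "q \<in> lab A" using assms(2) A by blast
  then have "sum w P = vec w q"
    unfolding vec_def using A finite_P by (intro sum.mono_neutral_right) auto
  then show ?thesis using assms(3) by simp
qed

end

section \<open>The order polytope\<close>

lemma continuous_on_coordinate: "continuous_on A (\<lambda>x::'q \<Rightarrow> real. x q)"
  by (rule continuous_on_subset[OF continuous_on_product_coordinates]) simp

text \<open>The extra 0 covers the empty family and makes the gauge built from it
  nonnegative.\<close>

lemma continuous_on_Max_insert:
  fixes L :: "('b::topological_space \<Rightarrow> real) set"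
  assumes "finite L" "\<And>l. l \<in> L \<Longrightarrow> continuous_on A l"
  shows "continuous_on A (\<lambda>v. Max (insert 0 ((\<lambda>l. l v) ` L)))"
  using assms
proof (induction L)
  case empty
  then show ?case by simp
next
  case (insert l L)
  have "Max (insert 0 ((\<lambda>l. l v) ` insert l L)) = max (l v) (Max (insert 0 ((\<lambda>l. l v) ` L)))" for v
  proof -
    have "Max (insert (l v) (insert 0 ((\<lambda>l. l v) ` L))) = max (l v) (Max (insert 0 ((\<lambda>l. l v) ` L)))"
      using insert.hyps by (intro Max_insert) auto
    then show ?thesis by (simp add: insert_commute)
  qed
  then show ?case
    using insert by (auto intro!: continuous_on_max)
qed

lemma Max_insert_scale:
  fixes l :: "('b \<Rightarrow> real)"
  assumes "finite L" "0 \<le> t"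
  shows "Max (insert 0 ((\<lambda>i. t * l i) ` L)) = t * Max (insert 0 (l ` L))"
proof -
  have "t * Max (insert 0 (l ` L)) = Max ((\<lambda>y. t * y) ` insert 0 (l ` L))"
    using assms by (intro mono_Max_commute) (auto intro!: monoI mult_left_mono)
  then show ?thesis by (simp add: image_image)
qed

context ideal_labelling
begin

definition order_polytope :: "('q \<Rightarrow> real) set" where
  "order_polytope = {x. (\<forall>q. q \<notin> Q \<longrightarrow> x q = 0) \<and> (\<forall>q. 0 \<le> x q \<and> x q \<le> 1) \<and> E_mono x}"

lemma ex_bot: obtains b where "b \<in> P" "lab b = {}"
  using ex_lab[of "{}"] by blast

lemma ex_top: obtains t where "t \<in> P" "lab t = Q"
  using ex_lab[of Q] E_subset by blast

lemma vec_drop_empty: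
  assumes "lab b = {}"
  shows "vec (w(b := c)) = vec w"
  unfolding vec_def using assms by (intro ext sum.cong) auto

text \<open>The empty ideal acts as a slack vertex. Injectivity is uniqueness after its weight is
  set to 0, and that weight is recovered from the total mass 1.\<close>

lemma geom_homeomorphic_order_polytope: "geom K homeomorphic order_polytope"
proof (rule homeomorphic_compact[OF compact_geom_K])
  obtain b where b: "b \<in> P" "lab b = {}" by (rule ex_bot)
  show "continuous_on (geom K) vec"
    by (intro continuous_on_coordinatewise_then_product continuous_on_vec)
  show "inj_on vec (geom K)"
  proof (rule inj_onI)
    fix f g assume "f \<in> geom K" "g \<in> geom K" and eq: "vec f = vec g"
    then have fg: "chain_weight f" "chain_weight g" "sum f P = 1" "sum g P = 1"
      by (simp_all add: geom_K_iff)
    have red: "chain_weight (h(b := 0)) \<and> (\<forall>A. (h(b := 0)) A \<noteq> 0 \<longrightarrow> lab A \<noteq> {})"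
      if "chain_weight h" for h
    proof (intro conjI allI impI)
      show "chain_weight (h(b := 0))"
        using that by (rule chain_weight_le) (use that in \<open>auto simp: chain_weight_def split: if_splits\<close>)
      fix A assume "(h(b := 0)) A \<noteq> 0"
      then have "A \<noteq> b" "h A \<noteq> 0" by (auto split: if_splits)
      then have "A \<in> P" using chain_weight_outside that by blast
      then show "lab A \<noteq> {}" using lab_inject b \<open>A \<noteq> b\<close> by metis
    qed
    have "f(b := 0) = g(b := 0)"
      using red[OF fg(1)] red[OF fg(2)] eq by (intro decomposition_unique) (auto simp: vec_drop_empty[OF b(2)])
    then have off: "f A = g A" if "A \<noteq> b" for A
      using that by (metis fun_upd_other)
    then have "sum f (P - {b}) = sum g (P - {b})" by (intro sum.cong) auto
    then have "f b = g b"
      using fg(3,4) sum.remove[OF finite_P b(1), of f] sum.remove[OF finite_P b(1), of g] by simp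
    then show "f = g" using off by (metis ext)
  qed
  show "vec ` geom K = order_polytope"
  proof (intro subset_antisym subsetI)
    fix x assume "x \<in> vec ` geom K"
    then obtain f where f: "chain_weight f" "sum f P = 1" "x = vec f"
      by (auto simp: geom_K_iff)
    then have nn: "\<And>A. 0 \<le> f A" by (simp add: chain_weight_def)
    have "vec f q \<le> 1" for q
      unfolding f(2)[symmetric] vec_def using finite_P nn by (intro sum_mono2) auto
    then show "x \<in> order_polytope"
      unfolding order_polytope_def using f nn by (auto simp: vec_outside vec_nonneg E_mono_vec)
  next
    fix x assume x: "x \<in> order_polytope"
    then obtain w where w: "\<And>A. 0 \<le> w A" "vec w = x"
      "\<And>A. w A \<noteq> 0 \<Longrightarrow> A \<in> P \<and> lab A \<noteq> {} \<and> (\<exists>s>0. lab A = {q. s \<le> x q})"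
      using ex_decomposition[of x] unfolding order_polytope_def by blast
    have C: "{A. w A \<noteq> 0} \<in> K"
    proof (rule superlevel_chain)
      fix A assume "A \<in> {A. w A \<noteq> 0}"
      then show "A \<in> P \<and> (\<exists>s. lab A = {q. s \<le> x q})" using w(3)[of A] by auto
    qed
    then have cw: "chain_weight w" using w(1) by (simp add: chain_weight_def)
    have le1: "sum w P \<le> 1"
      using cw by (rule sum_le_of_vec_le) (use w x in \<open>auto simp: order_polytope_def\<close>)
    have wb: "w b = 0" using w(3) b by blast
    \<comment> \<open>The missing mass goes to the empty ideal; \<open>le1\<close> makes it
      nonnegative.\<close>
    define f where "f = w(b := 1 - sum w P)"
    have "sum f P = 1"
    proof -
      have "sum f (P - {b}) = sum w (P - {b})" by (intro sum.cong) (auto simp: f_def)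
      then show ?thesis
        using sum.remove[OF finite_P b(1), of f] sum.remove[OF finite_P b(1), of w] wb
        by (simp add: f_def)
    qed
    moreover have "insert b {A. w A \<noteq> 0} \<in> K"
      using C b unfolding K_iff by auto
    then have "{A. f A \<noteq> 0} \<in> K"
      by (rule K_subset) (auto simp: f_def)
    then have "chain_weight f" using w(1) le1 by (auto simp: chain_weight_def f_def)
    moreover have "vec f = x" using w(2) vec_drop_empty[OF b(2)] by (simp add: f_def)
    ultimately show "x \<in> vec ` geom K"
      by (auto simp: geom_K_iff)
  qed
qed

text \<open>Translated by an interior point \<open>c\<close>, the polytope is the unit sublevel set
  of its gauge, so radial rescaling applies.\<close>

lemma order_polytope_homeomorphic_unit_ball:
  "order_polytope homeomorphic {x. (\<forall>q. q \<notin> Q \<longrightarrow> x q = (0::real)) \<and> L2_set x Q \<le> 1}"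
proof -
  define R where "R = (\<Sum>q\<in>Q. r q)"
  have rR: "r q \<le> R" if "q \<in> Q" for q
    unfolding R_def using finite_Q that by (intro member_le_sum) auto
  \<comment> \<open>Strictly decreasing in the rank, with values between 1 / (R + 2) and (R + 1) /
    (R + 2): every defining inequality of the polytope is strict at \<open>c\<close>.\<close>
  define c where "c = (\<lambda>q. if q \<in> Q then (real R + 1 - real (r q)) / (real R + 2) else 0)"
  have c01: "0 < c q" "c q < 1" if "q \<in> Q" for q
    using rR[OF that] that by (simp_all add: c_def)
  have c_less: "c q < c p" if "(p, q) \<in> E" for p q
    using that E_subset rank_less[OF that] by (auto simp: c_def divide_strict_right_mono)
  \<comment> \<open>Each inequality, written for \<open>c + v\<close> and divided by its slack at
    \<open>c\<close>, reads \<open>l v \<le> 1\<close> with \<open>l\<close> linear.\<close>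
  define L where "L = (\<lambda>q v. - v q / c q) ` Q \<union> (\<lambda>q v. v q / (1 - c q)) ` Q
    \<union> (\<lambda>(p, q) v. (v q - v p) / (c p - c q)) ` E"
  define g where "g = (\<lambda>v::'q \<Rightarrow> real. Max (insert 0 ((\<lambda>l. l v) ` L)))"
  have finL: "finite L" using finite_Q finite_E by (simp add: L_def)
  have contL: "continuous_on UNIV l" if "l \<in> L" for l
    using that c01 c_less unfolding L_def
    by (force intro!: continuous_intros continuous_on_coordinate)
  have homL: "l (\<lambda>q. t * v q) = t * l v" if "l \<in> L" for l t v
    using that unfolding L_def by (auto simp: field_simps)
  have g_ge: "l v \<le> g v" if "l \<in> L" for l v
    unfolding g_def using finL that by (intro Max_ge) auto
  have gE: "g v \<le> 1 \<longleftrightarrow> (\<forall>q. 0 \<le> v q + c q \<and> v q + c q \<le> 1) \<and> E_mono (\<lambda>q. v q + c q)"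
    if "\<forall>q. q \<notin> Q \<longrightarrow> v q = 0" for v
  proof -
    have "g v \<le> 1 \<longleftrightarrow> (\<forall>l\<in>L. l v \<le> 1)"
      unfolding g_def using finL by simp
    also have "\<dots> \<longleftrightarrow> (\<forall>q\<in>Q. - v q / c q \<le> 1) \<and> (\<forall>q\<in>Q. v q / (1 - c q) \<le> 1)
        \<and> (\<forall>(p, q)\<in>E. (v q - v p) / (c p - c q) \<le> 1)"
      unfolding L_def by (simp add: ball_Un case_prod_unfold)
    also have "(\<forall>q\<in>Q. - v q / c q \<le> 1) \<longleftrightarrow> (\<forall>q\<in>Q. 0 \<le> v q + c q)"
      using c01 by (intro ball_cong) (auto simp: field_simps)
    also have "(\<forall>q\<in>Q. v q / (1 - c q) \<le> 1) \<longleftrightarrow> (\<forall>q\<in>Q. v q + c q \<le> 1)"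
      using c01 by (intro ball_cong) (auto simp: divide_le_eq)
    also have "(\<forall>(p, q)\<in>E. (v q - v p) / (c p - c q) \<le> 1) \<longleftrightarrow> E_mono (\<lambda>q. v q + c q)"
    proof -
      have "(v q - v p) / (c p - c q) \<le> 1 \<longleftrightarrow> v q + c q \<le> v p + c p" if "(p, q) \<in> E" for p q
        using c_less[OF that] by (auto simp: divide_le_eq)
      then show ?thesis unfolding E_mono_def by blast
    qed
    finally show ?thesis using that by (auto simp: c_def)
  qed
  have "homeomorphism order_polytope {v. (\<forall>q. q \<notin> Q \<longrightarrow> v q = 0) \<and> g v \<le> 1}
    (\<lambda>x q. x q - c q) (\<lambda>v q. v q + c q)"
  proof (rule homeomorphismI)
    show "continuous_on order_polytope (\<lambda>x q. x q - c q)"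
      by (intro continuous_intros continuous_on_coordinate)
    show "continuous_on {v. (\<forall>q. q \<notin> Q \<longrightarrow> v q = 0) \<and> g v \<le> 1} (\<lambda>v q. v q + c q)"
      by (intro continuous_intros continuous_on_coordinate)
    show "(\<lambda>x q. x q - c q) ` order_polytope \<subseteq> {v. (\<forall>q. q \<notin> Q \<longrightarrow> v q = 0) \<and> g v \<le> 1}"
    proof clarify
      fix x assume x: "x \<in> order_polytope"
      then have "\<forall>q. q \<notin> Q \<longrightarrow> x q - c q = 0" by (simp add: order_polytope_def c_def)
      moreover from this x have "g (\<lambda>q. x q - c q) \<le> 1"
        by (subst gE) (auto simp: order_polytope_def)
      ultimately show "(\<forall>q. q \<notin> Q \<longrightarrow> x q - c q = 0) \<and> g (\<lambda>q. x q - c q) \<le> 1" by blast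
    qed
    show "(\<lambda>v q. v q + c q) ` {v. (\<forall>q. q \<notin> Q \<longrightarrow> v q = 0) \<and> g v \<le> 1} \<subseteq> order_polytope"
    proof clarify
      fix v assume v: "\<forall>q. q \<notin> Q \<longrightarrow> v q = 0" "g v \<le> 1"
      then show "(\<lambda>q. v q + c q) \<in> order_polytope"
        using gE[OF v(1)] by (simp add: order_polytope_def c_def)
    qed
  qed auto
  then have hom1: "order_polytope homeomorphic {v. (\<forall>q. q \<notin> Q \<longrightarrow> v q = 0) \<and> g v \<le> 1}"
    using homeomorphic_def by blast
  \<comment> \<open>Compactness of the sublevel set is inherited from the realization by way of the
    polytope.\<close>
  moreover have "compact order_polytope"
    using geom_homeomorphic_order_polytope compact_geom_K homeomorphic_compactness by blast
  then have "compact {v. (\<forall>q. q \<notin> Q \<longrightarrow> v q = 0) \<and> g v \<le> 1}"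
    using hom1 homeomorphic_compactness by blast
  then have "{v. (\<forall>q. q \<notin> Q \<longrightarrow> v q = 0) \<and> g v \<le> 1} homeomorphic
      {x. (\<forall>q. q \<notin> Q \<longrightarrow> x q = (0::real)) \<and> L2_set x Q \<le> 1}"
  proof (rule gauge_ball_homeomorphic_unit_ball[OF finite_Q, rotated 4])
    show "continuous_on UNIV g"
      unfolding g_def using finL contL by (rule continuous_on_Max_insert)
    show "g (\<lambda>q. t * v q) = t * g v" if "0 \<le> t" for t v
    proof -
      have "(\<lambda>l. l (\<lambda>q. t * v q)) ` L = (\<lambda>l. t * l v) ` L"
        using homL by (intro image_cong) auto
      then show ?thesis unfolding g_def using Max_insert_scale[OF finL that] by metis
    qed
    show "0 \<le> g v" for v unfolding g_def using finL by (intro Max_ge) auto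
    show "\<bar>v q\<bar> \<le> g v" if q: "q \<in> Q" for q v
    \<comment> \<open>The box constraints alone bound the coordinates, because \<open>c q\<close>
      and \<open>1 - c q\<close> are less than 1.\<close>
    proof (cases "0 \<le> v q")
      case True
      have "v q \<le> v q / (1 - c q)" using c01[OF q] True by (simp add: le_divide_eq mult_left_le)
      also have "\<dots> \<le> g v" by (rule g_ge) (use q in \<open>auto simp: L_def\<close>)
      finally show ?thesis using True by simp
    next
      case False
      have "- v q \<le> - v q / c q" using c01[OF q] False by (simp add: field_simps)
      also have "\<dots> \<le> g v" by (rule g_ge) (use q in \<open>auto simp: L_def\<close>)
      finally show ?thesis using False by simp
    qed
  qed
  ultimately show ?thesis using homeomorphic_trans by blast
qed

theorem realization_homeomorphic_ball: "realization K homeomorphic_space closed_ball_space (card Q)"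
proof -
  have "geom K homeomorphic {x. (\<forall>q. q \<notin> Q \<longrightarrow> x q = (0::real)) \<and> L2_set x Q \<le> 1}"
    using geom_homeomorphic_order_polytope order_polytope_homeomorphic_unit_ball homeomorphic_trans
    by blast
  then show ?thesis
    unfolding realization_eq
    using homeomorphic_imp_homeomorphic_space unit_ball_homeomorphic_closed_ball_space[OF finite_Q refl]
      homeomorphic_space_trans by blast
qed

end

section \<open>Links\<close>

lemma contractibleI:
  fixes S :: "'b::topological_space set"
  assumes "continuous_on ({0..1} \<times> S) h" "h ` ({0..1::real} \<times> S) \<subseteq> S"
    "\<And>x. x \<in> S \<Longrightarrow> h (0, x) = x" "\<And>x. x \<in> S \<Longrightarrow> h (1, x) = a"
  shows "contractible S"
proof -
  have "continuous_map (prod_topology (top_of_set {0..1}) (top_of_set S)) (top_of_set S) h"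
    using assms(1,2)
    by (auto simp: prod_topology_subtopology_eu continuous_map_in_subtopology image_subset_iff)
  then have "homotopic_with_canon (\<lambda>x. True) S S id (\<lambda>x. a)"
    using assms(3,4) by (subst homotopic_with) (auto intro!: exI[of _ h])
  then show ?thesis unfolding contractible_def by blast
qed

lemma continuous_on_snd_coordinate:
  "continuous_on X (\<lambda>z::'c::topological_space \<times> ('q \<Rightarrow> real). snd z q)"
  by (rule continuous_on_product_then_coordinatewise[OF continuous_on_snd[OF continuous_on_id]])

text \<open>Straight-line contraction to the vertex \<open>v\<close>: the support stays inside
  \<open>insert v F\<close>, a face by assumption.\<close>

lemma contractible_geom_cone:
  assumes "finite P" "\<And>F. F \<in> L \<Longrightarrow> F \<subseteq> P" "\<And>F G. F \<in> L \<Longrightarrow> G \<subseteq> F \<Longrightarrow> G \<in> L"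
    and v: "v \<in> P" "\<And>F. F \<in> L \<Longrightarrow> insert v F \<in> L"
  shows "contractible (geom L)"
proof (rule contractibleI)
  have iff: "f \<in> geom L \<longleftrightarrow> (\<forall>x. 0 \<le> f x) \<and> {x. f x \<noteq> 0} \<in> L \<and> sum f P = 1" for f
    by (rule geom_iff[OF assms(1-3)])
  define h where "h = (\<lambda>(t, f) x. (1 - t) * f x + t * (if x = v then 1 else (0::real)))"
  show "continuous_on ({0..1} \<times> geom L) h"
    unfolding h_def case_prod_unfold
    by (rule continuous_on_coordinatewise_then_product)
      (intro continuous_intros continuous_on_snd_coordinate)
  show "h ` ({0..1} \<times> geom L) \<subseteq> geom L"
  proof clarify
    fix t :: real and f assume t: "t \<in> {0..1}" and f: "f \<in> geom L"
    then have f': "\<And>x. 0 \<le> f x" "{x. f x \<noteq> 0} \<in> L" "sum f P = 1" unfolding iff by simp_all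
    have "{x. h (t, f) x \<noteq> 0} \<subseteq> insert v {x. f x \<noteq> 0}"
      by (auto simp: h_def)
    then have "{x. h (t, f) x \<noteq> 0} \<in> L" using v(2)[OF f'(2)] assms(3) by blast
    moreover have "0 \<le> h (t, f) x" for x using t f'(1) by (simp add: h_def)
    moreover have "sum (h (t, f)) P = 1"
      using f'(3) v(1) assms(1) by (simp add: h_def sum.distrib flip: sum_distrib_left)
    ultimately show "h (t, f) \<in> geom L" unfolding iff by simp
  qed
  show "h (0, f) = f" for f by (simp add: h_def)
  show "h (1, f) = (\<lambda>x. if x = v then 1 else 0)" for f by (auto simp: h_def)
qed

section \<open>Lengths of chains and cone points of links\<close>

context ideal_labelling
begin

text \<open>The members of a chain of ideals have distinct sizes, all between 0 and
  \<open>card Q\<close>.\<close>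

lemma card_chain_le: "C \<in> K \<Longrightarrow> card C \<le> card Q + 1"
proof -
  assume C: "C \<in> K"
  have "inj_on (\<lambda>A. card (lab A)) C"
  proof (rule inj_onI)
    fix A B assume AB: "A \<in> C" "B \<in> C" "card (lab A) = card (lab B)"
    then have "A \<in> P" "B \<in> P" "lab A \<subseteq> lab B \<or> lab B \<subseteq> lab A" using C unfolding K_iff by blast+
    moreover from this have "finite (lab A)" "finite (lab B)"
      using lab_subset finite_Q finite_subset by blast+
    ultimately have "lab A = lab B" using AB(3) card_subset_eq by metis
    then show "A = B" using \<open>A \<in> P\<close> \<open>B \<in> P\<close> lab_inject by blast
  qed
  moreover have "card (lab A) \<le> card Q" if "A \<in> C" for A
    using that C lab_subset[of A] finite_Q unfolding K_iff by (intro card_mono) auto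
  then have "(\<lambda>A. card (lab A)) ` C \<subseteq> {0..card Q}" by auto
  ultimately have "card C \<le> card {0..card Q}"
    by (intro card_inj_on_le) auto
  then show ?thesis by simp
qed

lemma link_subset: "G \<in> sc_link K F \<Longrightarrow> G \<subseteq> P"
  unfolding sc_link_def K_iff by blast

lemma link_down: "G \<in> sc_link K F \<Longrightarrow> H \<subseteq> G \<Longrightarrow> H \<in> sc_link K F"
  unfolding sc_link_def using K_subset[of G H] K_subset[of "G \<union> F" "H \<union> F"] by blast

lemma finite_link: "finite (sc_link K F)"
  using finite_K by (rule finite_subset[rotated]) (auto simp: sc_link_def)

lemma compact_geom_link: "compact (geom (sc_link K F))"
  by (rule compact_geom[OF finite_link]) (use link_subset finite_P finite_subset in blast)

lemma geom_link_iff: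
  "f \<in> geom (sc_link K F) \<longleftrightarrow> (\<forall>x. 0 \<le> f x) \<and> {x. f x \<noteq> 0} \<in> sc_link K F \<and> sum f P = 1"
  by (rule geom_iff[OF finite_P link_subset link_down])

text \<open>An ideal comparable with everything can join every face of the link. This serves for the
  empty and the full ideal when \<open>F\<close> omits them.\<close>

lemma contractible_link_cone:
  assumes "v \<in> P" "v \<notin> F" "\<And>A. A \<in> P \<Longrightarrow> lab A \<subseteq> lab v \<or> lab v \<subseteq> lab A"
  shows "contractible (geom (sc_link K F))"
proof (rule contractible_geom_cone[where P = P and v = v])
  show "finite P" "v \<in> P" using finite_P assms(1) by auto
  show "\<And>G. G \<in> sc_link K F \<Longrightarrow> G \<subseteq> P" by (rule link_subset)
  show "\<And>G H. G \<in> sc_link K F \<Longrightarrow> H \<subseteq> G \<Longrightarrow> H \<in> sc_link K F" by (rule link_down)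
  fix G assume G: "G \<in> sc_link K F"
  have "insert v C \<in> K" if "C \<in> K" for C
    using that assms(1,3) unfolding K_iff by (metis insert_iff insert_subset order_refl subsetD)
  from this[of G] this[of "G \<union> F"] show "insert v G \<in> sc_link K F"
    using G assms(2) unfolding sc_link_def by simp
qed

end

section \<open>Links of chains containing both extreme ideals\<close>

locale ideal_labelling_link = ideal_labelling +
  fixes F b t
  assumes F: "F \<in> order_complex P rel"
    and b: "b \<in> F" "lab b = {}" and t: "t \<in> F" "lab t = Q"
begin

text \<open>The blocks cut out by \<open>F\<close> are the fibres of this number on
  \<open>Q\<close>. In this locale \<open>'a\<close> is the type of the elements of
  \<open>Q\<close>, and \<open>'b\<close> is the type of the vertices.\<close>

definition level :: "'a \<Rightarrow> nat" where
  "level q = card {B \<in> F. q \<in> lab B}"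

text \<open>A representative of the block of \<open>q\<close>; the choice refers to the level only,
  so the whole block shares it.\<close>

definition base :: "'a \<Rightarrow> 'a" where
  "base q = (SOME q'. q' \<in> Q \<and> level q' = level q)"

text \<open>Coordinates for functions modulo block constants: such a function is normalised to
  vanish at the representatives.\<close>

definition S :: "'a set" where
  "S = Q - base ` Q"

definition cone :: "('a \<Rightarrow> real) set" where
  "cone = {y. (\<forall>q. q \<notin> S \<longrightarrow> y q = 0) \<and> (\<forall>(p, q)\<in>E. level p = level q \<longrightarrow> y q \<le> y p)}"

definition reduce :: "('b \<Rightarrow> real) \<Rightarrow> 'a \<Rightarrow> real" where
  "reduce w q = (if q \<in> Q then vec w q - vec w (base q) else 0)"

definition link_weight :: "('b \<Rightarrow> real) \<Rightarrow> bool" where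
  "link_weight w \<longleftrightarrow> (\<forall>A. 0 \<le> w A) \<and> {A. w A \<noteq> 0} \<in> sc_link K F"

lemma F_subset: "F \<subseteq> P" and F_chain: "A \<in> F \<Longrightarrow> B \<in> F \<Longrightarrow> lab A \<subseteq> lab B \<or> lab B \<subseteq> lab A"
  using F unfolding K_iff by blast+

lemma finite_F: "finite F"
  using F_subset finite_P finite_subset by blast

text \<open>In a chain, a member separating \<open>q\<close> from \<open>q'\<close> forces every
  member that contains \<open>q'\<close> to contain \<open>q\<close>.\<close>

lemma level_less:
  assumes "B \<in> F" "q \<in> lab B" "q' \<notin> lab B"
  shows "level q' < level q"
proof -
  have "{B \<in> F. q' \<in> lab B} \<subset> {B \<in> F. q \<in> lab B}"
  proof
    show "{B \<in> F. q' \<in> lab B} \<subseteq> {B \<in> F. q \<in> lab B}"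
      using assms F_chain by blast
    show "{B \<in> F. q' \<in> lab B} \<noteq> {B \<in> F. q \<in> lab B}"
      using assms by blast
  qed
  then show ?thesis unfolding level_def using finite_F by (intro psubset_card_mono) auto
qed

lemma level_eq: "level q = level q' \<Longrightarrow> B \<in> F \<Longrightarrow> q \<in> lab B \<longleftrightarrow> q' \<in> lab B"
  using level_less by (metis less_irrefl)

lemma level_mono_E: "(p, q) \<in> E \<Longrightarrow> level q \<le> level p"
  unfolding level_def using finite_F F_subset lab_closed by (intro card_mono) auto

lemma level_ge_1: "q \<in> Q \<Longrightarrow> 1 \<le> level q"
  unfolding level_def using finite_F t by (auto simp: Suc_le_eq card_gt_0_iff)

lemma level_le: "level q \<le> card F - 1"
proof -
  have "level q \<le> card (F - {b})"
    unfolding level_def using finite_F b by (intro card_mono) auto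
  then show ?thesis using b(1) by simp
qed

lemma base: assumes "q \<in> Q" shows "base q \<in> Q" "level (base q) = level q"
  using someI[of "\<lambda>q'. q' \<in> Q \<and> level q' = level q" q] assms unfolding base_def by auto

lemma base_cong: "level q = level q' \<Longrightarrow> base q = base q'"
  by (simp add: base_def)

lemma finite_S: "finite S"
  using finite_Q by (simp add: S_def)

text \<open>There are at most \<open>card F - 1\<close> blocks: membership in \<open>t\<close> makes
  every level on \<open>Q\<close> at least 1, and \<open>b\<close> is never counted.\<close>

lemma card_S: "card Q + 1 \<le> card S + card F"
proof -
  have sub: "base ` Q \<subseteq> Q" using base by blast
  have "base ` Q = (\<lambda>k. SOME q'. q' \<in> Q \<and> level q' = k) ` level ` Q"
    unfolding base_def by (simp add: image_image)
  then have "card (base ` Q) \<le> card (level ` Q)"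
    using finite_Q by (simp add: card_image_le)
  also have "\<dots> \<le> card {1..card F - 1}"
    using level_ge_1 level_le by (intro card_mono) auto
  finally have "card (base ` Q) \<le> card F - 1" by simp
  moreover have "card S = card Q - card (base ` Q)"
    unfolding S_def using sub finite_Q by (meson card_Diff_subset finite_imageI)
  moreover have "card (base ` Q) \<le> card Q" using sub finite_Q card_mono by blast
  moreover have "card F \<ge> 1" using b finite_F by (auto simp: Suc_le_eq card_gt_0_iff)
  ultimately show ?thesis by linarith
qed

text \<open>A face of the link together with \<open>F\<close> is a chain, so its size is at most
  \<open>card Q + 1 - card F\<close>, which \<open>card_S\<close> bounds by \<open>card S\<close>.
  Hence vanishing below degree \<open>card S - 1\<close> covers all degrees below the dimension of
  the link.\<close>

lemma sc_dim_link: "sc_dim (sc_link K F) \<le> int (card S) - 1"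
proof -
  have "card G \<le> card S" if "G \<in> sc_link K F" for G
  proof -
    have "G \<inter> F = {}" "G \<union> F \<in> K" "G \<subseteq> P"
      using that link_subset unfolding sc_link_def by blast+
    then have "card G + card F \<le> card Q + 1"
      using card_chain_le[of "G \<union> F"] finite_F finite_subset[OF _ finite_P, of G]
      by (simp add: card_Un_disjoint)
    then show ?thesis using card_S by linarith
  qed
  moreover have "sc_link K F \<noteq> {}"
    using F K_subset[OF F, of "{}"] unfolding sc_link_def by auto
  ultimately have "Max (card ` sc_link K F) \<le> card S"
    using finite_link by (subst Max_le_iff) auto
  then show ?thesis by (simp add: sc_dim_def)
qed

lemma reduce_scale: "reduce (\<lambda>A. c * w A) q = c * reduce w q"
  by (simp add: reduce_def vec_scale right_diff_distrib)

lemma reduce_zero: "reduce (\<lambda>_. 0) = (\<lambda>_. 0)"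
  by (auto simp: reduce_def vec_zero)

lemma base_notin_S: "q \<in> Q \<Longrightarrow> base q \<notin> S"
  by (simp add: S_def)

text \<open>Inside a block both ends of an edge are lowered by the same value, that at the
  representative.\<close>

lemma reduce_in_cone:
  assumes "\<And>A. 0 \<le> w A"
  shows "reduce w \<in> cone"
proof -
  have "reduce w q = 0" if "q \<notin> S" for q
  proof (cases "q \<in> Q")
    case True
    then obtain q1 where q1: "q1 \<in> Q" "q = base q1" using \<open>q \<notin> S\<close> by (auto simp: S_def)
    then have "base q = q" using base base_cong by metis
    then show ?thesis by (simp add: reduce_def)
  qed (simp add: reduce_def)
  moreover have "reduce w q \<le> reduce w p" if "(p, q) \<in> E" "level p = level q" for p q
    using that E_subset E_mono_vec[of w] assms base_cong[OF that(2)]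
    unfolding E_mono_def reduce_def by auto
  ultimately show ?thesis unfolding cone_def by auto
qed

lemma vec_indicator: "vec (\<lambda>A. if A \<in> F then 1 else 0) q = level q"
proof -
  have "vec (\<lambda>A. if A \<in> F then 1 else 0) q = card {A \<in> {A \<in> P. q \<in> lab A}. A \<in> F}"
    unfolding vec_def using finite_P by (subst sum.inter_filter[symmetric]) auto
  also have "{A \<in> {A \<in> P. q \<in> lab A}. A \<in> F} = {B \<in> F. q \<in> lab B}"
    using F_subset by blast
  finally show ?thesis by (simp add: level_def)
qed

text \<open>Members of \<open>F\<close> contain a block entirely or not at all, so weights on them
  become invisible after \<open>reduce\<close>.\<close>

lemma vec_supported_on_F:
  assumes "\<And>A. A \<notin> F \<Longrightarrow> w A = 0" "level q = level q'"
  shows "vec w q = vec w q'"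
proof -
  have "vec w p = (\<Sum>A\<in>F. if p \<in> lab A then w A else 0)" for p
  proof -
    have "vec w p = (\<Sum>A | A \<in> F \<and> p \<in> lab A. w A)"
      unfolding vec_def using finite_P F_subset assms(1) by (intro sum.mono_neutral_right) auto
    then show ?thesis using finite_F by (simp add: sum.inter_filter)
  qed
  moreover have "(\<Sum>A\<in>F. if q \<in> lab A then w A else 0) = (\<Sum>A\<in>F. if q' \<in> lab A then w A else 0)"
    using level_eq[OF assms(2)] by (intro sum.cong) auto
  ultimately show ?thesis by simp
qed

text \<open>Adding a large multiple of the level function \<open>level\<close> makes any function that respects the
  constraints inside the blocks of \<open>F\<close> respect all of them, with the ideals of \<open>F\<close> among the
  superlevel sets.\<close>

lemma ex_lift:
  assumes y: "\<And>p q. (p, q) \<in> E \<Longrightarrow> level p = level q \<Longrightarrow> y q \<le> (y p :: real)"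
  shows "\<exists>M x a. 0 < M \<and> (\<forall>q. x q = (if q \<in> Q then y q + M * real (level q) else 0)) \<and>
    (\<forall>p q. q \<in> Q \<longrightarrow> level p < level q \<longrightarrow> x p < x q) \<and> (\<forall>A. 0 \<le> a A) \<and> vec a = x \<and>
    (\<forall>A. a A \<noteq> 0 \<longrightarrow> A \<in> P \<and> lab A \<noteq> {} \<and> (\<exists>s>0. lab A = {q. s \<le> x q}))"
proof -
  \<comment> \<open>\<open>M\<close> exceeds every difference \<open>y p - y q\<close>, so that one
    step of the level outweighs \<open>y\<close>; the summand 1 makes this strict and
    \<open>M\<close> positive.\<close>
  define M where "M = 1 + 2 * (\<Sum>q\<in>Q. \<bar>y q\<bar>)"
  define x where "x = (\<lambda>q. if q \<in> Q then y q + M * real (level q) else 0)"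
  have yM: "2 * \<bar>y q\<bar> < M" if "q \<in> Q" for q
    using member_le_sum[of q Q "\<lambda>q. \<bar>y q\<bar>"] that finite_Q by (simp add: M_def)
  have "0 \<le> (\<Sum>q\<in>Q. \<bar>y q\<bar>)" by (simp add: sum_nonneg)
  then have M: "0 < M" unfolding M_def by linarith
  have xpos: "0 < x q" if "q \<in> Q" for q
  proof -
    have "M * 1 \<le> M * real (level q)" using M level_ge_1[OF that] by (intro mult_left_mono) auto
    then show ?thesis using yM[OF that] that by (auto simp: x_def)
  qed
  have x_less: "x p < x q" if "q \<in> Q" "level p < level q" for p q
  proof (cases "p \<in> Q")
    case True
    have "M * (real (level p) + 1) \<le> M * real (level q)" using M that(2) by (intro mult_left_mono) auto
    then show ?thesis using yM[OF True] yM[OF that(1)] True that(1) by (simp add: x_def algebra_simps)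
  next
    case False
    then show ?thesis using xpos[OF that(1)] by (simp add: x_def)
  qed
  have "E_mono x"
    unfolding E_mono_def
  proof clarify
    fix p q assume pq: "(p, q) \<in> E"
    show "x q \<le> x p"
    proof (cases "level p = level q")
      case True
      then show ?thesis using y[OF pq] pq E_subset by (auto simp: x_def)
    next
      case False
      then have "level q < level p" using level_mono_E[OF pq] by simp
      then show ?thesis using x_less[of p q] pq E_subset by fastforce
    qed
  qed
  moreover have "0 \<le> x q" for q
    using xpos[of q] by (cases "q \<in> Q") (auto simp: x_def)
  moreover have "x q = 0" if "q \<notin> Q" for q using that by (simp add: x_def)
  ultimately obtain a where "(\<forall>A. 0 \<le> a A) \<and> (\<forall>A. a A \<noteq> 0 \<longrightarrow> A \<in> P \<and> lab A \<noteq> {} \<and>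
      (\<exists>s>0. lab A = {q. s \<le> x q})) \<and> vec a = x"
    using ex_decomposition[of x] by auto
  moreover have "\<forall>q. x q = (if q \<in> Q then y q + M * real (level q) else 0)" by (simp add: x_def)
  ultimately show ?thesis using M x_less by blast
qed

lemma link_weight_nonempty: "link_weight w \<Longrightarrow> w A \<noteq> 0 \<Longrightarrow> A \<notin> F \<and> lab A \<noteq> {}"
proof -
  assume "link_weight w" "w A \<noteq> 0"
  then have "{A. w A \<noteq> 0} \<inter> F = {}" "A \<in> P"
    using link_subset[of "{A. w A \<noteq> 0}"] unfolding link_weight_def sc_link_def by auto
  then have "A \<notin> F" using \<open>w A \<noteq> 0\<close> by blast
  then show ?thesis using lab_inject[OF \<open>A \<in> P\<close>, of b] b F_subset by auto
qed

lemma link_weight_add_F: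
  assumes "link_weight w" "\<And>A. 0 \<le> v A" "\<And>A. A \<notin> F \<Longrightarrow> v A = 0"
  shows "chain_weight (\<lambda>A. w A + v A)"
proof -
  have "{A. w A \<noteq> 0} \<union> F \<in> K" using assms(1) by (simp add: link_weight_def sc_link_def)
  then have "{A. w A + v A \<noteq> 0} \<in> K"
    by (rule K_subset) (use assms(3) in force)
  then show ?thesis using assms by (simp add: chain_weight_def link_weight_def)
qed

text \<open>The difference \<open>d\<close> of the two vectors is constant on blocks. Its lift
  \<open>d + M * level\<close> is a combination \<open>a\<close> of members of \<open>F\<close>, and
  \<open>M * level\<close> is a combination \<open>e\<close> of them too. So \<open>w + e\<close>
  and \<open>w' + a\<close> have the same vector, and uniqueness identifies \<open>w\<close> with
  \<open>w'\<close> off \<open>F\<close>.\<close>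

lemma reduce_inject:
  assumes w: "link_weight w" "link_weight w'" and eq: "reduce w = reduce w'"
  shows "w = w'"
proof -
  define d where "d = (\<lambda>q. vec w q - vec w' q)"
  have d_bs: "d q = d (base q)" if "q \<in> Q" for q
    using fun_cong[OF eq, of q] that by (simp add: reduce_def d_def)
  have d_eq: "d p = d q" if "p \<in> Q" "q \<in> Q" "level p = level q" for p q
    using d_bs[OF that(1)] d_bs[OF that(2)] base_cong[OF that(3)] by simp
  have dE: "d q \<le> d p" if "(p, q) \<in> E" "level p = level q" for p q
    using that d_eq[of p q] E_subset by auto
  obtain M x a where lift: "0 < M \<and> (\<forall>q. x q = (if q \<in> Q then d q + M * real (level q) else 0)) \<and>
    (\<forall>p q. q \<in> Q \<longrightarrow> level p < level q \<longrightarrow> x p < x q) \<and> (\<forall>A. 0 \<le> a A) \<and> vec a = x \<and>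
    (\<forall>A. a A \<noteq> 0 \<longrightarrow> A \<in> P \<and> lab A \<noteq> {} \<and> (\<exists>s>0. lab A = {q. s \<le> x q}))"
    using ex_lift[of d] dE by blast
  then have M: "0 < M" and x: "\<And>q. x q = (if q \<in> Q then d q + M * real (level q) else 0)"
    and x_less: "\<And>p q. q \<in> Q \<Longrightarrow> level p < level q \<Longrightarrow> x p < x q"
    and a: "\<And>A. 0 \<le> a A" "vec a = x"
      "\<And>A. a A \<noteq> 0 \<Longrightarrow> A \<in> P \<and> lab A \<noteq> {} \<and> (\<exists>s>0. lab A = {q. s \<le> x q})"
    by blast+
  have x_le: "x p \<le> x q" if "p \<in> Q" "q \<in> Q" "level p \<le> level q" for p q
  proof (cases "level p = level q")
    case True
    then show ?thesis using that d_eq[of p q] x by simp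
  next
    case False
    then show ?thesis using that x_less[of q p] by simp
  qed
  \<comment> \<open>A superlevel set of \<open>x\<close> consists of the blocks whose level is at
    least that of its lowest element \<open>q0\<close>, so it is the smallest member of
    \<open>F\<close> containing \<open>q0\<close>.\<close>
  have aF: "A \<in> F" if "a A \<noteq> 0" for A
  proof -
    obtain s where s: "A \<in> P" "lab A \<noteq> {}" "lab A = {q. s \<le> x q}" using a(3)[OF \<open>a A \<noteq> 0\<close>] by blast
    have AQ: "lab A \<subseteq> Q" using lab_subset s(1) by blast
    obtain q0 where q0: "q0 \<in> lab A" "\<And>q. q \<in> lab A \<Longrightarrow> level q0 \<le> level q"
      using s(2) ex_has_least_nat[of "\<lambda>q. q \<in> lab A" _ level] by blast
    have "finite (lab ` {B \<in> F. q0 \<in> lab B})" "lab ` {B \<in> F. q0 \<in> lab B} \<noteq> {}"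
      using finite_F t q0 AQ by auto
    from finite_has_minimal[OF this] obtain B0 where B0: "B0 \<in> F" "q0 \<in> lab B0"
      "\<And>B. B \<in> F \<Longrightarrow> q0 \<in> lab B \<Longrightarrow> lab B \<subseteq> lab B0 \<Longrightarrow> lab B0 = lab B"
      by auto
    have "q \<in> lab B0" if "q \<in> lab A" for q
      using level_less[OF B0(1,2), of q] q0(2)[OF that] by linarith
    moreover have "q \<in> lab A" if "q \<in> lab B0" for q
    proof -
      have "{B \<in> F. q0 \<in> lab B} \<subseteq> {B \<in> F. q \<in> lab B}"
        using that B0 F_chain by blast
      then have "level q0 \<le> level q" unfolding level_def using finite_F by (intro card_mono) auto
      moreover have "q \<in> Q" using that B0(1) F_subset lab_subset by blast
      ultimately have "x q0 \<le> x q" using x_le q0(1) AQ by blast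
      then show ?thesis using q0(1) s(3) by auto
    qed
    ultimately have "lab A = lab B0" by blast
    then show ?thesis using lab_inject s(1) B0(1) F_subset by blast
  qed
  \<comment> \<open>Weight \<open>M\<close> on every member of \<open>F\<close> yields
    \<open>M * level\<close>. Leaving out the empty ideal \<open>b\<close> does not change this and
    meets the hypothesis of uniqueness.\<close>
  define e where "e = (\<lambda>A. M * ((\<lambda>A. if A \<in> F then 1 else 0)(b := 0)) A)"
  have e: "vec e q = M * real (level q)" for q
    unfolding e_def vec_scale vec_drop_empty[OF b(2)] vec_indicator by simp
  have e0: "0 \<le> e A" "A \<notin> F \<Longrightarrow> e A = 0" "e A \<noteq> 0 \<Longrightarrow> lab A \<noteq> {}" for A
    using M b F_subset lab_inject[of A b] by (auto simp: e_def split: if_splits)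
  have "(\<lambda>A. w A + e A) = (\<lambda>A. w' A + a A)"
  proof (rule decomposition_unique)
    show "chain_weight (\<lambda>A. w A + e A)" by (rule link_weight_add_F[OF w(1) e0(1,2)])
    show "chain_weight (\<lambda>A. w' A + a A)" using w(2) a(1) aF by (intro link_weight_add_F) auto
    show "vec (\<lambda>A. w A + e A) = vec (\<lambda>A. w' A + a A)"
    proof
      fix q
      show "vec (\<lambda>A. w A + e A) q = vec (\<lambda>A. w' A + a A) q"
        by (cases "q \<in> Q") (simp_all add: vec_add e a(2) x d_def vec_outside flip: e)
    qed
    show "lab A \<noteq> {}" if "w A + e A \<noteq> 0" for A
      using that link_weight_nonempty[OF w(1), of A] e0(3)[of A] by fastforce
    show "lab A \<noteq> {}" if "w' A + a A \<noteq> 0" for A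
      using that link_weight_nonempty[OF w(2), of A] a(3)[of A] by fastforce
  qed
  then have *: "w A + e A = w' A + a A" for A by metis
  show ?thesis
  proof
    fix A
    show "w A = w' A"
    proof (cases "A \<in> F")
      case True
      then show ?thesis using link_weight_nonempty w by metis
    next
      case False
      then show ?thesis using *[of A] e0(2) aF by fastforce
    qed
  qed
qed

text \<open>Decompose a steep lift of \<open>y\<close> and discard the weights on \<open>F\<close>,
  which contribute only block constants. The remaining members form a chain with \<open>F\<close>
  because the lift increases with the level.\<close>

lemma reduce_surj:
  assumes y: "y \<in> cone"
  obtains w where "link_weight w" "reduce w = y"
proof -
  have yE: "y q \<le> y p" if "(p, q) \<in> E" "level p = level q" for p q
    using y that unfolding cone_def by blast
  have yS: "y q = 0" if "q \<notin> S" for q using y that unfolding cone_def by blast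
  obtain M x a where lift: "0 < M \<and> (\<forall>q. x q = (if q \<in> Q then y q + M * real (level q) else 0)) \<and>
    (\<forall>p q. q \<in> Q \<longrightarrow> level p < level q \<longrightarrow> x p < x q) \<and> (\<forall>A. 0 \<le> a A) \<and> vec a = x \<and>
    (\<forall>A. a A \<noteq> 0 \<longrightarrow> A \<in> P \<and> lab A \<noteq> {} \<and> (\<exists>s>0. lab A = {q. s \<le> x q}))"
    using ex_lift[of y] yE by blast
  then have M: "0 < M" and x: "\<And>q. x q = (if q \<in> Q then y q + M * real (level q) else 0)"
    and x_less: "\<And>p q. q \<in> Q \<Longrightarrow> level p < level q \<Longrightarrow> x p < x q"
    and a: "\<And>A. 0 \<le> a A" "vec a = x"
      "\<And>A. a A \<noteq> 0 \<Longrightarrow> A \<in> P \<and> lab A \<noteq> {} \<and> (\<exists>s>0. lab A = {q. s \<le> x q})"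
    by blast+
  have aK: "{A. a A \<noteq> 0} \<in> K"
  proof (rule superlevel_chain)
    fix A assume "A \<in> {A. a A \<noteq> 0}"
    then show "A \<in> P \<and> (\<exists>s. lab A = {q. s \<le> x q})" using a(3)[of A] by auto
  qed
  \<comment> \<open>An element of \<open>B\<close> has larger level, hence larger \<open>x\<close>,
    than one outside \<open>B\<close>; a superlevel set containing the latter contains the
    former.\<close>
  have cmp: "lab A \<subseteq> lab B \<or> lab B \<subseteq> lab A" if aA: "a A \<noteq> 0" and BF: "B \<in> F" for A B
  proof (rule ccontr)
    assume "\<not> (lab A \<subseteq> lab B \<or> lab B \<subseteq> lab A)"
    then obtain p q where pq: "p \<in> lab A" "p \<notin> lab B" "q \<in> lab B" "q \<notin> lab A" by blast
    obtain s where s: "lab A = {q. s \<le> x q}" using a(3)[OF aA] by blast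
    have "q \<in> Q" using pq(3) BF F_subset lab_subset by blast
    then have "x p < x q" using x_less level_less[OF BF pq(3,2)] by blast
    then show False using pq s by auto
  qed
  define w where "w = (\<lambda>A. if A \<in> F then 0 else a A)"
  define v where "v = (\<lambda>A. if A \<in> F then a A else 0)"
  have "{A. a A \<noteq> 0} \<union> F \<in> K"
    using aK F cmp unfolding K_iff by (simp add: ball_Un) blast
  then have "{A. w A \<noteq> 0} \<union> F \<in> K"
    by (rule K_subset) (auto simp: w_def)
  moreover have "{A. w A \<noteq> 0} \<in> K" using aK by (rule K_subset) (auto simp: w_def)
  moreover have "{A. w A \<noteq> 0} \<inter> F = {}" by (auto simp: w_def)
  ultimately have "link_weight w"
    using a(1) unfolding link_weight_def sc_link_def by (auto simp: w_def)
  moreover have "reduce w = y"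
  proof
    fix q
    show "reduce w q = y q"
    proof (cases "q \<in> Q")
      case True
      note bq = base[OF True]
      have "vec a p = vec w p + vec v p" for p
        unfolding vec_add[symmetric] by (rule arg_cong[of _ _ "\<lambda>f. vec f p"]) (auto simp: w_def v_def)
      moreover have "vec v q = vec v (base q)"
        by (rule vec_supported_on_F) (simp_all add: v_def bq)
      ultimately have "reduce w q = x q - x (base q)"
        using True a(2) by (simp add: reduce_def)
      \<comment> \<open>The term \<open>M * level\<close> cancels, since \<open>q\<close> and
        \<open>base q\<close> have the same level.\<close>
      also have "\<dots> = y q - y (base q)" using True bq by (simp add: x)
      finally show ?thesis using yS[OF base_notin_S[OF True]] by simp
    next
      case False
      then show ?thesis using yS[of q] by (simp add: reduce_def S_def)
    qed
  qed
  ultimately show ?thesis using that by blast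
qed

lemma cone_scale: "y \<in> cone \<Longrightarrow> 0 \<le> c \<Longrightarrow> (\<lambda>q. c * y q) \<in> cone"
  unfolding cone_def by (auto intro: mult_left_mono)

lemma cone_add: "y \<in> cone \<Longrightarrow> z \<in> cone \<Longrightarrow> (\<lambda>q. y q + z q) \<in> cone"
  unfolding cone_def by (auto intro!: add_mono)

lemma L2_set_cone_eq_0: "y \<in> cone \<Longrightarrow> L2_set y S = 0 \<Longrightarrow> y = (\<lambda>_. 0)"
  using finite_S unfolding cone_def by (auto simp: L2_set_eq_0_iff fun_eq_iff)

text \<open>\<open>reduce\<close> is positively homogeneous and bijective from link weights onto the
  cone. Each nonzero ray of link weights has one point of mass 1, and its image ray has one point of
  norm 1.\<close>

lemma geom_link_homeomorphic:
  "geom (sc_link K F) homeomorphic {y \<in> cone. L2_set y S = 1}"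
proof (rule homeomorphic_compact[OF compact_geom_link])
  define N where "N = (\<lambda>w. L2_set (reduce w) S)"
  define f where "f = (\<lambda>w q. reduce w q / N w)"
  have lw: "link_weight w" "sum w P = 1" if "w \<in> geom (sc_link K F)" for w
    using that by (simp_all add: geom_link_iff link_weight_def)
  have redc: "reduce w \<in> cone" if "link_weight w" for w
    using that reduce_in_cone by (simp add: link_weight_def)
  \<comment> \<open>The zero weight has the empty face as support; injectivity against it shows that
    \<open>reduce\<close> vanishes nowhere else.\<close>
  have lw0: "link_weight (\<lambda>_. 0)"
    using F K_subset[OF F, of "{}"] by (simp add: link_weight_def sc_link_def)
  have Npos: "0 < N w" if "link_weight w" "sum w P = 1" for w
  proof -
    have "N w \<noteq> 0"
    proof
      assume "N w = 0"
      then have "reduce w = reduce (\<lambda>_. 0)"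
        using L2_set_cone_eq_0[OF redc[OF that(1)]] reduce_zero by (simp add: N_def)
      then have "w = (\<lambda>_. 0)" using reduce_inject that(1) lw0 by blast
      then show False using that(2) by simp
    qed
    then show ?thesis by (simp add: N_def less_le)
  qed
  have lw_scale: "link_weight (\<lambda>A. c * w A)" if "link_weight w" "0 < c" for w c
    using that by (simp add: link_weight_def)
  have contr: "continuous_on (geom (sc_link K F)) (\<lambda>w. reduce w q)" for q
    unfolding reduce_def by (cases "q \<in> Q") (auto intro!: continuous_intros continuous_on_vec)
  have "continuous_on (geom (sc_link K F)) N"
    unfolding N_def L2_set_def by (intro continuous_intros contr)
  then show "continuous_on (geom (sc_link K F)) f"
    unfolding f_def using Npos lw
    by (intro continuous_on_coordinatewise_then_product continuous_on_divide contr) force+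
  show "inj_on f (geom (sc_link K F))"
  proof (rule inj_onI)
    fix v w assume v: "v \<in> geom (sc_link K F)" and w: "w \<in> geom (sc_link K F)" and eq: "f v = f w"
    have N: "0 < N v" "0 < N w" using Npos lw v w by auto
    define c where "c = N v / N w"
    have "reduce v q = reduce (\<lambda>A. c * w A) q" for q
      unfolding reduce_scale using fun_cong[OF eq, of q] N by (simp add: f_def c_def field_simps)
    then have vw: "v = (\<lambda>A. c * w A)"
      using lw(1)[OF v] lw_scale[OF lw(1)[OF w], of c] N by (intro reduce_inject) (auto simp: c_def)
    then have "sum v P = c * sum w P" by (simp add: sum_distrib_left)
    then have "c = 1" using lw v w by simp
    then show "v = w" using vw by simp
  qed
  show "f ` geom (sc_link K F) = {y \<in> cone. L2_set y S = 1}"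
  proof (intro subset_antisym subsetI)
    fix y assume "y \<in> f ` geom (sc_link K F)"
    then obtain w where w: "w \<in> geom (sc_link K F)" "y = f w" by blast
    then have N: "0 < N w" using Npos lw by auto
    have yw: "y = (\<lambda>q. (1 / N w) * reduce w q)" using w by (simp add: f_def)
    have "y \<in> cone" unfolding yw using N redc lw w by (intro cone_scale) auto
    moreover have "L2_set y S = 1 / N w * N w"
      unfolding yw N_def by (rule L2_set_scale) simp
    ultimately show "y \<in> {y \<in> cone. L2_set y S = 1}" using N by simp
  next
    fix y assume y: "y \<in> {y \<in> cone. L2_set y S = 1}"
    then obtain w where w: "link_weight w" "reduce w = y" using reduce_surj by blast
    have "w \<noteq> (\<lambda>_. 0)" using w(2) y reduce_zero by (auto simp: L2_set_def)
    then obtain A where A: "w A \<noteq> 0" by (auto simp: fun_eq_iff)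
    have nn: "\<And>A. 0 \<le> w A" and "{A. w A \<noteq> 0} \<subseteq> P"
      using w(1) link_subset by (auto simp: link_weight_def)
    then have "A \<in> P" "0 < w A" using A by (auto simp: less_le)
    then have pos: "0 < sum w P" using nn finite_P by (intro sum_pos2) auto
    define c where "c = 1 / sum w P"
    have c: "0 < c" using pos by (simp add: c_def)
    define v where "v = (\<lambda>A. c * w A)"
    have "v \<in> geom (sc_link K F)"
      using lw_scale[OF w(1) c] pos unfolding geom_link_iff v_def link_weight_def
      by (simp add: c_def flip: sum_divide_distrib)
    moreover have reduce_v: "reduce v = (\<lambda>q. c * y q)" using w(2) by (auto simp: v_def reduce_scale)
    then have "N v = c" using L2_set_scale[of c y S] c y by (simp add: N_def)
    then have "f v = y" using reduce_v c by (simp add: f_def)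
    ultimately show "y \<in> f ` geom (sc_link K F)" by blast
  qed
qed

text \<open>Move along segments to a fixed strictly monotone \<open>c\<close> and normalise. The
  edge inside a block keeps these segments away from 0.\<close>

lemma contractible_cone_sphere:
  assumes pq: "(p, q) \<in> E" "level p = level q"
  shows "contractible {y \<in> cone. L2_set y S = 1}" (is "contractible ?D")
proof (rule contractibleI)
  \<comment> \<open>The negated rank, shifted on each block so as to vanish at its
    representative.\<close>
  define c where "c = (\<lambda>q. if q \<in> Q then real (r (base q)) - real (r q) else 0)"
  have "c q = 0" if "q \<notin> S" for q
  proof (cases "q \<in> Q")
    case True
    then obtain q1 where q1: "q1 \<in> Q" "q = base q1" using \<open>q \<notin> S\<close> by (auto simp: S_def)
    then have "base q = q" using base base_cong by metis
    then show ?thesis by (simp add: c_def)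
  qed (simp add: c_def)
  moreover have c_less: "c q < c p" if "(p, q) \<in> E" "level p = level q" for p q
    using that E_subset rank_less[OF that(1)] base_cong[OF that(2)] by (auto simp: c_def)
  ultimately have c: "c \<in> cone"
    unfolding cone_def by (auto intro: less_imp_le)
  define z where "z = (\<lambda>(s::real, y) q. (1 - s) * y q + s * c q)"
  define h where "h = (\<lambda>sy q. 1 / L2_set (z sy) S * z sy q)"
  have zc: "z (s, y) \<in> cone" if "s \<in> {0..1}" "y \<in> ?D" for s y
    using that c unfolding z_def by (simp add: cone_add cone_scale)
  have N: "0 < L2_set (z (s, y)) S" if "s \<in> {0..1}" "y \<in> ?D" for s y
  proof -
    have "L2_set (z (s, y)) S \<noteq> 0"
    proof
      assume 0: "L2_set (z (s, y)) S = 0"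
      then have z0: "z (s, y) q = 0" for q
        using L2_set_cone_eq_0[OF zc[OF that]] by simp
      show False
      proof (cases "s = 0")
        case True
        then show False using 0 that(2) by (simp add: z_def)
      next
        case False
        \<comment> \<open>For \<open>s > 0\<close> the strict inequality of \<open>c\<close> on the
          edge survives in \<open>z\<close>, whereas the zero function takes equal values.\<close>
        have "y q \<le> y p" using that(2) pq unfolding cone_def by blast
        then have "(1 - s) * y q \<le> (1 - s) * y p" using that(1) by (intro mult_left_mono) auto
        moreover have "s * c q < s * c p" using False that(1) c_less[OF pq] by simp
        ultimately show False using z0[of p] z0[of q] by (simp add: z_def)
      qed
    qed
    then show ?thesis by (simp add: less_le)
  qed
  have contz: "continuous_on ({0..1} \<times> ?D) (\<lambda>sy. z sy q)" for q
    unfolding z_def case_prod_unfold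
    by (intro continuous_intros continuous_on_snd_coordinate)
  show "continuous_on ({0..1} \<times> ?D) h"
  proof (rule continuous_on_coordinatewise_then_product)
    have "continuous_on ({0..1} \<times> ?D) z"
      by (rule continuous_on_coordinatewise_then_product) (rule contz)
    then have "continuous_on ({0..1} \<times> ?D) (\<lambda>sy. L2_set (z sy) S)"
      by (rule continuous_on_compose2[OF continuous_on_L2_set[of UNIV]]) simp
    moreover have "\<forall>sy\<in>{0..1::real} \<times> ?D. L2_set (z sy) S \<noteq> 0"
    proof
      fix sy :: "real \<times> ('a \<Rightarrow> real)"
      assume "sy \<in> {0..1} \<times> ?D"
      then show "L2_set (z sy) S \<noteq> 0" using N[of "fst sy" "snd sy"] by (cases sy) auto
    qed
    ultimately show "continuous_on ({0..1} \<times> ?D) (\<lambda>sy. h sy q)" for q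
      unfolding h_def
      by (rule continuous_on_mult[OF continuous_on_divide[OF continuous_on_const] contz])
  qed
  show "h ` ({0..1} \<times> ?D) \<subseteq> ?D"
  proof (rule image_subsetI)
    fix sy assume "sy \<in> {0..1::real} \<times> ?D"
    then obtain s y where sy: "sy = (s, y)" "s \<in> {0..1}" "y \<in> ?D" by blast
    note n = N[OF sy(2,3)]
    have "h sy \<in> cone" unfolding h_def sy(1) using zc[OF sy(2,3)] n by (intro cone_scale) auto
    moreover have "L2_set (h sy) S = 1 / L2_set (z sy) S * L2_set (z sy) S"
      unfolding h_def by (rule L2_set_scale) simp
    ultimately show "h sy \<in> ?D" using n sy(1) by simp
  qed
  show "h (0, y) = y" if "y \<in> ?D" for y
    using that by (simp add: h_def z_def)
  show "h (1, y) = (\<lambda>q. 1 / L2_set c S * c q)" for y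
    by (simp add: h_def z_def)
qed

lemma trivial_homology_link:
  assumes "i < sc_dim (sc_link K F)"
  shows "trivial_group (reduced_homology_group i (realization (sc_link K F)))"
proof -
  have i: "i < int (card S) - 1" using assms sc_dim_link by linarith
  have hom: "top_of_set (geom (sc_link K F)) homeomorphic_space top_of_set {y \<in> cone. L2_set y S = 1}"
    using geom_link_homeomorphic homeomorphic_imp_homeomorphic_space by blast
  have iso: "trivial_group (reduced_homology_group i (top_of_set (geom (sc_link K F))))"
    if "top_of_set {y \<in> cone. L2_set y S = 1} homeomorphic_space Y" "trivial_group (reduced_homology_group i Y)"
    for Y :: "(nat \<Rightarrow> real) topology"
  proof -
    have "reduced_homology_group i (top_of_set (geom (sc_link K F))) \<cong> reduced_homology_group i Y"
      using homeomorphic_space_trans[OF hom that(1)]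
      by (rule homeomorphic_space_imp_isomorphic_reduced_homology_groups)
    then show ?thesis
      using isomorphic_group_triviality that(2) by (metis group_reduced_homology_group)
  qed
  show ?thesis
    unfolding realization_eq
  proof (cases "\<exists>(p, q)\<in>E. level p = level q")
    case True
    then have "contractible_space (top_of_set {y \<in> cone. L2_set y S = 1})"
      using contractible_cone_sphere by auto
    then have "contractible_space (top_of_set (geom (sc_link K F)))"
      using hom homeomorphic_space_contractibility by blast
    then show "trivial_group (reduced_homology_group i (top_of_set (geom (sc_link K F))))"
      by (rule trivial_reduced_homology_group_contractible_space)
  next
    case False
    \<comment> \<open>Without edges inside blocks the cone is the whole coordinate space over
      \<open>S\<close>.\<close>
    then have D: "{y \<in> cone. L2_set y S = 1} = {x. (\<forall>q. q \<notin> S \<longrightarrow> x q = 0) \<and> L2_set x S = 1}"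
      unfolding cone_def by blast
    show "trivial_group (reduced_homology_group i (top_of_set (geom (sc_link K F))))"
    proof (cases "card S")
      case 0
      \<comment> \<open>Here \<open>i < -1\<close>, and reduced homology vanishes in negative
        degrees.\<close>
      then show ?thesis using i by (simp add: trivial_reduced_homology_group)
    next
      case (Suc d)
      then have "i \<noteq> int d" using i by simp
      then show ?thesis
        using iso[of "nsphere d"] unit_sphere_homeomorphic_nsphere[OF finite_S Suc]
        by (simp add: D trivial_reduced_homology_group_nsphere)
    qed
  qed
qed

end

context ideal_labelling
begin

theorem cohen_macaulay: "cohen_macaulay_Z K"
  unfolding cohen_macaulay_Z_def
proof (intro ballI allI impI)
  fix F i assume F: "F \<in> K" and i: "i < sc_dim (sc_link K F)"
  obtain b where b: "b \<in> P" "lab b = {}" by (rule ex_bot)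
  obtain t where t: "t \<in> P" "lab t = Q" by (rule ex_top)
  show "trivial_group (reduced_homology_group i (realization (sc_link K F)))"
  proof (cases "b \<in> F \<and> t \<in> F")
    case True
    then interpret ideal_labelling_link Q E r P rel lab F b t
      using F b t by unfold_locales auto
    show ?thesis using i by (rule trivial_homology_link)
  next
    case False
    have "contractible (geom (sc_link K F))"
    proof (cases "b \<in> F")
      case True
      then show ?thesis
        using False t lab_subset by (intro contractible_link_cone[of t]) auto
    next
      case False
      then show ?thesis
        using b by (intro contractible_link_cone[of b]) auto
    qed
    then show ?thesis
      unfolding realization_eq
      by (intro trivial_reduced_homology_group_contractible_space) simp
  qed
qed

end

section \<open>The tableau order as an ideal lattice\<close>

definition cnt :: "nat set \<Rightarrow> nat \<Rightarrow> nat" where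
  "cnt A t = card {a \<in> A. a \<le> t}"

text \<open>In the sorted list the entries up to \<open>t\<close> form an initial segment of length
  \<open>cnt A t\<close>; indices start at 0, hence the strict inequality. This Galois connection
  turns entrywise comparison into comparison of counts.\<close>

lemma kth_le_iff_less_cnt:
  assumes "finite A" "k < card A"
  shows "kth A k \<le> t \<longleftrightarrow> k < cnt A t"
proof -
  define xs where "xs = sorted_list_of_set A"
  have xs: "sorted xs" "distinct xs" "set xs = A" "length xs = card A"
    using assms(1) by (simp_all add: xs_def)
  have "bij_betw ((!) xs) {i. i < length xs \<and> xs ! i \<le> t} {a \<in> A. a \<le> t}"
    unfolding bij_betw_def
    using xs by (auto simp: inj_on_def nth_eq_iff_index_eq in_set_conv_nth image_iff)
  then have cnt: "cnt A t = card {i. i < length xs \<and> xs ! i \<le> t}"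
    unfolding cnt_def by (simp add: bij_betw_same_card)
  show ?thesis
  proof (cases "xs ! k \<le> t")
    case True
    have "xs ! i \<le> t" if "i \<le> k" for i
      using True sorted_nth_mono[OF xs(1), of i k] that assms(2) xs(4) by simp
    then have "{..k} \<subseteq> {i. i < length xs \<and> xs ! i \<le> t}"
      using assms(2) xs(4) by auto
    from card_mono[OF _ this] have "k < cnt A t" unfolding cnt by simp
    then show ?thesis using True by (simp add: kth_def xs_def)
  next
    case False
    have "i < k" if "i < length xs" "xs ! i \<le> t" for i
    proof (rule ccontr)
      assume "\<not> i < k"
      then have "xs ! k \<le> xs ! i" using sorted_nth_mono[OF xs(1), of k i] that by simp
      then show False using False that by simp
    qed
    then have "{i. i < length xs \<and> xs ! i \<le> t} \<subseteq> {..<k}" by auto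
    from card_mono[OF _ this] have "\<not> k < cnt A t" unfolding cnt by simp
    then show ?thesis using False by (simp add: kth_def xs_def)
  qed
qed

lemma T_finite: "A \<in> T n \<Longrightarrow> finite A"
  unfolding T_def using finite_subset by blast

lemma cnt_0: "A \<in> T n \<Longrightarrow> cnt A 0 = 0"
  by (auto simp: T_def cnt_def)

lemma cnt_Suc: "A \<in> T n \<Longrightarrow> cnt A (Suc t) = cnt A t + (if Suc t \<in> A then 1 else 0)"
proof -
  assume "A \<in> T n"
  then have "finite A" by (rule T_finite)
  have "{a \<in> A. a \<le> Suc t} = (if Suc t \<in> A then insert (Suc t) {a \<in> A. a \<le> t} else {a \<in> A. a \<le> t})"
    by (auto simp: le_Suc_eq)
  then show ?thesis using \<open>finite A\<close> by (simp add: cnt_def)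
qed

lemma cnt_n: "A \<in> T n \<Longrightarrow> cnt A n = card A"
  unfolding cnt_def T_def by (rule arg_cong[of _ _ card]) auto

lemma cnt_n_pos: "A \<in> T n \<Longrightarrow> 1 \<le> cnt A n"
  using cnt_n T_finite[of A n] by (auto simp: Suc_le_eq card_gt_0_iff T_def)

lemma cnt_le: "A \<in> T n \<Longrightarrow> cnt A t \<le> t"
  by (induction t) (auto simp: cnt_0 cnt_Suc)

lemma cnt_mono: "A \<in> T n \<Longrightarrow> s \<le> t \<Longrightarrow> cnt A s \<le> cnt A t"
  unfolding cnt_def using T_finite by (intro card_mono) auto

text \<open>Smaller entries mean larger counts, which reverses the order; the size condition is the
  case \<open>t = n\<close>.\<close>

lemma tab_le_iff:
  assumes A: "A \<in> T n" and B: "B \<in> T n"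
  shows "tab_le n A B \<longleftrightarrow> (\<forall>t\<le>n. cnt B t \<le> cnt A t)"
proof
  assume le: "tab_le n A B"
  show "\<forall>t\<le>n. cnt B t \<le> cnt A t"
  proof (intro allI impI)
    fix t assume "t \<le> n"
    show "cnt B t \<le> cnt A t"
    proof (cases "cnt B t")
      case (Suc k)
      have k: "k < card B" "k < card A"
        using cnt_mono[OF B \<open>t \<le> n\<close>] Suc cnt_n[OF B] le by (auto simp: tab_le_def)
      have "kth B k \<le> t" using kth_le_iff_less_cnt[OF T_finite[OF B] k(1)] Suc by simp
      then have "kth A k \<le> t" using le k(1) unfolding tab_le_def by (meson le_trans)
      then show ?thesis using kth_le_iff_less_cnt[OF T_finite[OF A] k(2)] Suc by simp
    qed simp
  qed
next
  assume le: "\<forall>t\<le>n. cnt B t \<le> cnt A t"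
  have card: "card B \<le> card A" using le cnt_n A B by (metis order_refl)
  have "kth A k \<le> kth B k" if k: "k < card B" for k
  proof -
    have "kth B k \<in> B"
      using nth_mem[of k "sorted_list_of_set B"] k T_finite[OF B] by (simp add: kth_def)
    then have "kth B k \<le> n" using B by (auto simp: T_def)
    moreover have "k < cnt B (kth B k)" using kth_le_iff_less_cnt[OF T_finite[OF B] k] by blast
    ultimately have "k < cnt A (kth B k)" using le less_le_trans by blast
    then show ?thesis using kth_le_iff_less_cnt[OF T_finite[OF A], of k] k card by simp
  qed
  then show "tab_le n A B" using A B card by (auto simp: tab_le_def T_def)
qed

lemma mem_iff_cnt:
  assumes "A \<in> T n"
  shows "a \<in> A \<longleftrightarrow> 1 \<le> a \<and> a \<le> n \<and> cnt A (a - 1) < cnt A a"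
proof (cases a)
  case 0
  then show ?thesis using assms by (auto simp: T_def)
next
  case (Suc b)
  then show ?thesis using cnt_Suc[OF assms, of b] assms by (auto simp: T_def)
qed

lemma cnt_inject:
  assumes "A \<in> T n" "B \<in> T n" "\<And>t. t \<le> n \<Longrightarrow> cnt A t = cnt B t"
  shows "A = B"
proof (rule Set.set_eqI)
  fix a
  show "a \<in> A \<longleftrightarrow> a \<in> B"
    unfolding mem_iff_cnt[OF assms(1)] mem_iff_cnt[OF assms(2)]
    using assms(3) by (metis diff_le_self le_trans)
qed

section \<open>The shifted staircase and its ideals\<close>

definition staircase :: "nat \<Rightarrow> (nat \<times> nat) set" where
  "staircase n = {(t, k). 1 \<le> k \<and> k \<le> t \<and> t \<le> n} - {(n, 1)}"

text \<open>The two kinds of edges encode that counts do not decrease and grow by at most one: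
  \<open>(t, k)\<close> forces \<open>(t + 1, k)\<close>, and \<open>(t + 1, k + 1)\<close> forces
  \<open>(t, k)\<close>.\<close>

definition staircase_edges :: "nat \<Rightarrow> ((nat \<times> nat) \<times> (nat \<times> nat)) set" where
  "staircase_edges n = {(p, q). p \<in> staircase n \<and> q \<in> staircase n \<and>
     (p = (Suc (fst q), snd q) \<or> q = (Suc (fst p), Suc (snd p)))}"

definition staircase_ideal :: "nat \<Rightarrow> nat set \<Rightarrow> (nat \<times> nat) set" where
  "staircase_ideal n A = {(t, k) \<in> staircase n. k \<le> cnt A t}"

lemma card_staircase:
  assumes "n \<ge> 1"
  shows "finite (staircase n)" "card (staircase n) = (n + 1 choose 2) - 1"
proof -
  have eq: "{(t, k). 1 \<le> k \<and> k \<le> t \<and> t \<le> n} = Sigma {1..n} (\<lambda>t. {1..t})" by auto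
  have "card (Sigma {1..n} (\<lambda>t. {1..t})) = (\<Sum>t=1..n. t)" by simp
  also have "\<dots> = n + 1 choose 2"
    by (induction n) (simp_all add: numeral_2_eq_2)
  finally have "card {(t, k). 1 \<le> k \<and> k \<le> t \<and> t \<le> n} = n + 1 choose 2" using eq by simp
  moreover have fin: "finite {(t, k). 1 \<le> k \<and> k \<le> t \<and> t \<le> n}" unfolding eq by simp
  ultimately show "finite (staircase n)" "card (staircase n) = (n + 1 choose 2) - 1"
    unfolding staircase_def using assms by (simp_all add: card_Diff_singleton)
qed

lemma staircase_ideal_subset_iff:
  assumes A: "A \<in> T n" and B: "B \<in> T n"
  shows "staircase_ideal n B \<subseteq> staircase_ideal n A \<longleftrightarrow> (\<forall>t\<le>n. cnt B t \<le> cnt A t)"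
proof
  assume sub: "staircase_ideal n B \<subseteq> staircase_ideal n A"
  show "\<forall>t\<le>n. cnt B t \<le> cnt A t"
  proof (intro allI impI)
    fix t assume t: "t \<le> n"
    show "cnt B t \<le> cnt A t"
    \<comment> \<open>No ideal records the box \<open>(n, 1)\<close>; there the inequality holds
      because \<open>A\<close> is nonempty.\<close>
    proof (cases "cnt B t = 0 \<or> (t, cnt B t) = (n, 1)")
      case True
      then show ?thesis using cnt_n_pos[OF A] by auto
    next
      case False
      then have "(t, cnt B t) \<in> staircase_ideal n B"
        using t cnt_le[OF B, of t] by (auto simp: staircase_ideal_def staircase_def)
      then show ?thesis using sub by (auto simp: staircase_ideal_def)
    qed
  qed
qed (auto simp: staircase_ideal_def staircase_def intro: le_trans)

lemma staircase_ideal_closed: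
  assumes A: "A \<in> T n" and pq: "(p, q) \<in> staircase_edges n" and q: "q \<in> staircase_ideal n A"
  shows "p \<in> staircase_ideal n A"
proof -
  obtain t k where tk: "q = (t, k)" by fastforce
  have "k \<le> cnt A t" using q tk by (simp add: staircase_ideal_def)
  then have "snd p \<le> cnt A (fst p)"
    using pq tk cnt_Suc[OF A, of "fst p"] cnt_mono[OF A, of t "Suc t"]
    by (auto simp: staircase_edges_def split: if_splits)
  then show ?thesis using pq by (auto simp: staircase_edges_def staircase_ideal_def)
qed

text \<open>With the first box put back, the column heights of an ideal start at 0 and grow by 0 or
  1; the wanted set is where they jump.\<close>

lemma staircase_ideal_surj:
  assumes n: "n \<ge> 1" and I: "I \<subseteq> staircase n"
    and closed: "\<And>p q. (p, q) \<in> staircase_edges n \<Longrightarrow> q \<in> I \<Longrightarrow> p \<in> I"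
  obtains A where "A \<in> T n" "staircase_ideal n A = I"
proof -
  define J where "J = insert (n, 1) I"
  define h where "h = (\<lambda>t. Max (insert 0 {k. (t, k) \<in> J}))"
  have Jle: "1 \<le> k" "k \<le> t" "t \<le> n" if "(t, k) \<in> J" for t k
    using that I n by (auto simp: J_def staircase_def)
  have fin: "finite {k. (t, k) \<in> J}" for t
    by (rule finite_subset[of _ "{..t}"]) (use Jle in auto)
  have diag: "(t, k) \<in> I" if "(Suc t, Suc k) \<in> J" "1 \<le> k" for t k
  proof -
    have "(Suc t, Suc k) \<in> I" using that by (auto simp: J_def)
    moreover have "((t, k), (Suc t, Suc k)) \<in> staircase_edges n"
      using Jle[OF that(1)] that(2) \<open>(Suc t, Suc k) \<in> I\<close> I
      by (auto simp: staircase_edges_def staircase_def)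
    ultimately show ?thesis using closed by blast
  qed
  have right: "(Suc t, k) \<in> J" if "(t, k) \<in> J" "t < n" for t k
  proof (cases "(Suc t, k) = (n, 1)")
    case True
    then show ?thesis by (simp add: J_def)
  next
    case False
    have "(t, k) \<in> I" using that by (auto simp: J_def)
    moreover have "((Suc t, k), (t, k)) \<in> staircase_edges n"
      using Jle[OF that(1)] that(2) False \<open>(t, k) \<in> I\<close> I
      by (auto simp: staircase_edges_def staircase_def)
    ultimately show ?thesis using closed by (auto simp: J_def)
  qed
  \<comment> \<open>A diagonal step down followed by a step to the right: columns have no
    gaps.\<close>
  have down: "(t, k) \<in> J" if tk: "(t, Suc k) \<in> J" "1 \<le> k" for t k
  proof -
    obtain s where s: "t = Suc s" using Jle[OF tk(1)] by (cases t) auto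
    then have "(s, k) \<in> J" using diag tk by (auto simp: J_def)
    then show ?thesis using right[of s k] s Jle(3)[OF tk(1)] by auto
  qed
  have downs: "(t, k) \<in> J" if "(t, m) \<in> J" "1 \<le> k" "k \<le> m" for t k m
    using that
  proof (induction m)
    case (Suc m)
    then show ?case using down[of t m] by (cases "k = Suc m") auto
  qed simp
  have J_iff: "(t, k) \<in> J \<longleftrightarrow> 1 \<le> k \<and> k \<le> h t" for t k
  proof
    assume "(t, k) \<in> J"
    then show "1 \<le> k \<and> k \<le> h t" using Jle fin unfolding h_def by (auto intro: Max_ge)
  next
    assume k: "1 \<le> k \<and> k \<le> h t"
    have "h t \<in> insert 0 {k. (t, k) \<in> J}" unfolding h_def using fin by (intro Max_in) auto
    then have "(t, h t) \<in> J" using k by auto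
    with k show "(t, k) \<in> J" using downs by blast
  qed
  have h_mono: "h t \<le> h (Suc t)" if "t < n" for t
  proof (cases "h t")
    case (Suc k)
    then have "(t, h t) \<in> J" using J_iff[of t "h t"] by simp
    then show ?thesis using right that J_iff by blast
  qed simp
  have h_Suc: "h (Suc t) \<le> h t + 1" for t
  proof (cases "h (Suc t) \<le> 1")
    case False
    then obtain k where k: "h (Suc t) = Suc k" "1 \<le> k" by (cases "h (Suc t)") auto
    then have "(t, k) \<in> J" using J_iff[of "Suc t" "Suc k"] diag by (simp add: J_def)
    then show ?thesis using k J_iff by simp
  qed simp
  have h0: "h 0 = 0"
  proof (rule ccontr)
    assume "h 0 \<noteq> 0"
    then have "(0, h 0) \<in> J" using J_iff[of 0 "h 0"] by simp
    then show False using Jle[of 0 "h 0"] \<open>h 0 \<noteq> 0\<close> by simp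
  qed
  define A where "A = {t \<in> {1..n}. h t = h (t - 1) + 1}"
  have cnt: "cnt A t = h t" if "t \<le> n" for t
    using that
  proof (induction t)
    case 0
    then show ?case by (auto simp: cnt_def A_def h0)
  next
    case (Suc t)
    have "{a \<in> A. a \<le> Suc t} = (if Suc t \<in> A then insert (Suc t) {a \<in> A. a \<le> t} else {a \<in> A. a \<le> t})"
      by (auto simp: le_Suc_eq)
    then have "cnt A (Suc t) = cnt A t + (if Suc t \<in> A then 1 else 0)"
      by (simp add: cnt_def)
    moreover have "Suc t \<in> A \<longleftrightarrow> h (Suc t) = h t + 1" using Suc.prems by (simp add: A_def)
    ultimately show ?case using Suc h_mono[of t] h_Suc[of t] by auto
  qed
  \<comment> \<open>The restored box \<open>(n, 1)\<close> makes the set nonempty.\<close>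
  have "1 \<le> h n" using J_iff[of n 1] by (simp add: J_def)
  then have "cnt A n \<noteq> 0" using cnt by simp
  then have "A \<noteq> {}" by (auto simp: cnt_def)
  then have "A \<in> T n" by (auto simp: T_def A_def)
  moreover have "staircase_ideal n A = I"
  proof (rule Set.set_eqI)
    fix q :: "nat \<times> nat"
    obtain t k where q: "q = (t, k)" by fastforce
    show "q \<in> staircase_ideal n A \<longleftrightarrow> q \<in> I"
    proof (cases "q \<in> staircase n")
      case True
      then have "1 \<le> k" "t \<le> n" "q \<noteq> (n, 1)" using q by (auto simp: staircase_def)
      then have "q \<in> I \<longleftrightarrow> k \<le> h t" using J_iff[of t k] q by (auto simp: J_def)
      then show ?thesis using True q cnt[OF \<open>t \<le> n\<close>] by (simp add: staircase_ideal_def)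
    next
      case False
      then show ?thesis using I by (auto simp: staircase_ideal_def)
    qed
  qed
  ultimately show ?thesis using that by blast
qed

lemma bij_betw_staircase_ideal:
  assumes "n \<ge> 1"
  shows "bij_betw (staircase_ideal n) (T n)
    {I. I \<subseteq> staircase n \<and> (\<forall>(p, q)\<in>staircase_edges n. q \<in> I \<longrightarrow> p \<in> I)}"
  unfolding bij_betw_def
proof
  show "inj_on (staircase_ideal n) (T n)"
  proof (rule inj_onI)
    fix A B assume AB: "A \<in> T n" "B \<in> T n" "staircase_ideal n A = staircase_ideal n B"
    then have "cnt A t = cnt B t" if "t \<le> n" for t
      using staircase_ideal_subset_iff that by (metis order_antisym order_refl)
    then show "A = B" using AB cnt_inject by blast
  qed
  show "staircase_ideal n ` T n =
    {I. I \<subseteq> staircase n \<and> (\<forall>(p, q)\<in>staircase_edges n. q \<in> I \<longrightarrow> p \<in> I)}" (is "_ = ?R")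
  proof
    show "staircase_ideal n ` T n \<subseteq> ?R"
      using staircase_ideal_closed by (force simp: staircase_ideal_def)
    show "?R \<subseteq> staircase_ideal n ` T n"
    proof
      fix I assume "I \<in> ?R"
      then have "I \<subseteq> staircase n" "\<And>p q. (p, q) \<in> staircase_edges n \<Longrightarrow> q \<in> I \<Longrightarrow> p \<in> I" by auto
      then show "I \<in> staircase_ideal n ` T n"
        using staircase_ideal_surj[OF assms] by (metis imageI)
    qed
  qed
qed

section \<open>The product formula for shifted tableaux\<close>

text \<open>Vieta's formulas for the two leading coefficients; the second produces the sums in
  \<open>sum_quotient_products\<close>.\<close>

lemma coeff_prod_linear:
  fixes g :: "'b \<Rightarrow> real"
  assumes "finite X"
  shows "poly.coeff (\<Prod>y\<in>X. [:- g y, 1:]) (card X) = 1 \<and>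
    (\<forall>k>card X. poly.coeff (\<Prod>y\<in>X. [:- g y, 1:]) k = 0) \<and>
    (X \<noteq> {} \<longrightarrow> poly.coeff (\<Prod>y\<in>X. [:- g y, 1:]) (card X - 1) = - sum g X)"
  using assms
proof (induction X)
  case empty
  then show ?case by auto
next
  case (insert x X)
  define p where "p = (\<Prod>y\<in>X. [:- g y, 1:])"
  have prod: "(\<Prod>y\<in>insert x X. [:- g y, 1:]) = Polynomial.smult (- g x) p + pCons 0 p"
    using insert.hyps by (simp add: p_def)
  have c: "poly.coeff p (card X) = 1" "\<And>k. k > card X \<Longrightarrow> poly.coeff p k = 0"
    "X \<noteq> {} \<Longrightarrow> poly.coeff p (card X - 1) = - sum g X"
    using insert.IH by (auto simp: p_def)
  have card: "card (insert x X) = Suc (card X)" using insert.hyps by simp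
  show ?case
  proof (intro conjI allI impI)
    show "poly.coeff (\<Prod>y\<in>insert x X. [:- g y, 1:]) (card (insert x X)) = 1"
      unfolding prod card by (simp add: c)
    show "poly.coeff (\<Prod>y\<in>insert x X. [:- g y, 1:]) k = 0" if "k > card (insert x X)" for k
      using that unfolding prod card by (cases k) (simp_all add: c)
    show "poly.coeff (\<Prod>y\<in>insert x X. [:- g y, 1:]) (card (insert x X) - 1) = - sum g (insert x X)"
    proof (cases "X = {}")
      case True
      then show ?thesis by simp
    next
      case False
      then obtain m where m: "card X = Suc m" using insert.hyps by (metis card_eq_0_iff not0_implies_Suc)
      then show ?thesis unfolding prod card using c False insert.hyps by simp
    qed
  qed
qed

lemma degree_prod_linear_le:
  fixes g :: "'b \<Rightarrow> real"
  assumes "finite X"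
  shows "degree (\<Prod>y\<in>X. [:- g y, 1:]) \<le> card X"
  using coeff_prod_linear[OF assms, of g] by (intro degree_le) blast

text \<open>Lagrange interpolation: the degree is below the number of nodes, so \<open>p\<close> is
  its own interpolant, and the numerators \<open>l x\<close> are monic of degree
  \<open>card X - 1\<close>.\<close>

lemma divided_difference:
  fixes f :: "'b \<Rightarrow> real" and p :: "real poly"
  assumes "finite X" "inj_on f X" "degree p < card X"
  shows "(\<Sum>x\<in>X. poly p (f x) / (\<Prod>y\<in>X - {x}. f x - f y)) = poly.coeff p (card X - 1)"
proof -
  define c where "c = (\<lambda>x. poly p (f x) / (\<Prod>y\<in>X - {x}. f x - f y))"
  define l where "l = (\<lambda>x. \<Prod>y\<in>X - {x}. [:- f y, 1:])"
  have nz: "(\<Prod>y\<in>X - {x}. f x - f y) \<noteq> 0" if "x \<in> X" for x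
    using assms that by (auto simp: inj_on_def)
  have deg: "degree (l x) \<le> card X - 1" if "x \<in> X" for x
    using degree_prod_linear_le[of "X - {x}" f] assms that by (simp add: l_def)
  have "p = (\<Sum>x\<in>X. Polynomial.smult (c x) (l x))"
  proof (rule poly_eqI_degree)
    fix z assume "z \<in> f ` X"
    then obtain x where x: "x \<in> X" "z = f x" by blast
    have "poly (\<Sum>x\<in>X. Polynomial.smult (c x) (l x)) z = (\<Sum>w\<in>X. c w * poly (l w) (f x))"
      by (simp add: poly_sum x)
    also have "\<dots> = (\<Sum>w\<in>X. if w = x then c x * poly (l x) (f x) else 0)"
    proof (rule sum.cong[OF refl])
      fix w assume "w \<in> X"
      have "poly (l w) (f x) = 0" if "w \<noteq> x"
        unfolding l_def poly_prod using assms x that by (intro prod_zero) auto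
      then show "c w * poly (l w) (f x) = (if w = x then c x * poly (l x) (f x) else 0)" by simp
    qed
    also have "\<dots> = c x * poly (l x) (f x)" using x assms by simp
    also have "\<dots> = poly p z" using nz[OF x(1)] x by (simp add: c_def l_def poly_prod)
    finally show "poly p z = poly (\<Sum>x\<in>X. Polynomial.smult (c x) (l x)) z" by simp
  next
    show "card (f ` X) > degree p" using assms by (simp add: card_image)
    have "degree (\<Sum>x\<in>X. Polynomial.smult (c x) (l x)) \<le> card X - 1"
      using deg by (intro degree_sum_le) (auto intro: order.trans[OF degree_smult_le] simp: assms)
    then show "card (f ` X) > degree (\<Sum>x\<in>X. Polynomial.smult (c x) (l x))" using assms by (simp add: card_image)
  qed
  then have "poly.coeff p (card X - 1) = (\<Sum>x\<in>X. c x * poly.coeff (l x) (card X - 1))"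
    by (simp add: coeff_sum)
  also have "\<dots> = (\<Sum>x\<in>X. c x)"
  proof (rule sum.cong[OF refl])
    fix x assume "x \<in> X"
    then show "c x * poly.coeff (l x) (card X - 1) = c x"
      using coeff_prod_linear[of "X - {x}" f] assms by (simp add: l_def)
  qed
  finally show ?thesis by (simp add: c_def)
qed

text \<open>Subtracting the product that vanishes at all nodes cancels the leading term and keeps
  the values there, so the divided difference applies.\<close>

lemma sum_quotient_products:
  fixes f g :: "'b \<Rightarrow> real"
  assumes "finite X" "inj_on f X"
  shows "(\<Sum>x\<in>X. (\<Prod>y\<in>X. f x - g y) / (\<Prod>y\<in>X - {x}. f x - f y)) = sum f X - sum g X"
proof (cases "X = {}")
  case False
  define p where "p = (\<Prod>y\<in>X. [:- g y, 1:]) - (\<Prod>y\<in>X. [:- f y, 1:])"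
  note cg = coeff_prod_linear[OF assms(1), of g] and cf = coeff_prod_linear[OF assms(1), of f]
  have "card X > 0" using False assms by (simp add: card_gt_0_iff)
  have "degree p \<le> card X - 1"
  proof (intro degree_le allI impI)
    fix k assume "card X - 1 < k"
    then have "k = card X \<or> k > card X" by linarith
    then show "poly.coeff p k = 0" using cg cf by (auto simp: p_def)
  qed
  then have "degree p < card X" using \<open>card X > 0\<close> by linarith
  from divided_difference[OF assms this]
  have "(\<Sum>x\<in>X. poly p (f x) / (\<Prod>y\<in>X - {x}. f x - f y)) = sum f X - sum g X"
    using cg cf False by (simp add: p_def)
  moreover have "poly p (f x) = (\<Prod>y\<in>X. f x - g y)" if "x \<in> X" for x
  proof -
    have "(\<Prod>y\<in>X. f x - f y) = 0" using that assms by (intro prod_zero) auto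
    then show ?thesis by (simp add: p_def poly_prod)
  qed
  ultimately show ?thesis by (simp cong: sum.cong)
qed simp

text \<open>The absolute value makes this factor symmetric. It is 0 for equal arguments, so
  forbidden box removals contribute nothing, and 1 if exactly one argument is 0, so a part that
  shrinks to 0 disappears.\<close>

definition pair_weight :: "nat \<Rightarrow> nat \<Rightarrow> real" where
  "pair_weight x y = \<bar>real x - real y\<bar> / (real x + real y)"

text \<open>For the strict partition with set of parts \<open>X\<close>, this is the number of shifted standard
  tableaux divided by the factorial of the size (Schur, Thrall).\<close>

definition tableau_density :: "nat set \<Rightarrow> real" where
  "tableau_density X = (\<Prod>x\<in>X. 1 / fact x) *
     (\<Prod>(x, y)\<in>{(x, y). x \<in> X \<and> y \<in> X \<and> x < y}. pair_weight x y)"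

lemma pair_weight_commute: "pair_weight x y = pair_weight y x"
  by (simp add: pair_weight_def add.commute abs_minus_commute)

lemma tableau_density_insert:
  assumes "finite X" "a \<notin> X"
  shows "tableau_density (insert a X) = tableau_density X * (1 / fact a * (\<Prod>y\<in>X. pair_weight a y))"
proof -
  define S where "S = {(x, y). x \<in> X \<and> y \<in> X \<and> x < y}"
  \<comment> \<open>Sorts the new pair, since the product runs over increasing pairs.\<close>
  define e where "e = (\<lambda>y. (min a y, max a y))"
  have finS: "finite S" using assms by (auto simp: S_def intro: finite_subset[of _ "X \<times> X"])
  have eq: "{(x, y). x \<in> insert a X \<and> y \<in> insert a X \<and> x < y} = S \<union> e ` X"
    using assms(2) by (auto simp: S_def e_def image_iff min_def max_def split: if_splits)
      (metis less_le_not_le linorder_neqE_nat nat_less_le)+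
  have disj: "S \<inter> e ` X = {}"
    using assms(2) by (auto simp: S_def e_def min_def max_def split: if_splits)
  have inj: "inj_on e X" by (auto simp: inj_on_def e_def min_def max_def split: if_splits)
  have "(\<Prod>(x, y)\<in>e ` X. pair_weight x y) = (\<Prod>y\<in>X. case e y of (x, z) \<Rightarrow> pair_weight x z)"
    by (simp add: prod.reindex[OF inj])
  also have "\<dots> = (\<Prod>y\<in>X. pair_weight a y)"
    by (intro prod.cong) (auto simp: e_def min_def max_def pair_weight_commute)
  finally have "(\<Prod>(x, y)\<in>e ` X. pair_weight x y) = (\<Prod>y\<in>X. pair_weight a y)" .
  then show ?thesis
    unfolding tableau_density_def eq using assms finS disj
    by (simp add: prod.union_disjoint S_def[symmetric])
qed

text \<open>The summand at \<open>x\<close> stands for removing a box from the part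
  \<open>x\<close>. With \<open>g y = f (y + 1)\<close> it is a multiple of a term of
  \<open>sum_quotient_products\<close>, and \<open>sum f X - sum g X\<close> is -2 times the
  size.\<close>

lemma tableau_density_recursion:
  assumes "finite X" "\<And>x. x \<in> X \<Longrightarrow> 1 \<le> x"
  shows "(\<Sum>x\<in>X. tableau_density (X - {x}) *
      (1 / fact (x - 1) * (\<Prod>y\<in>X - {x}. pair_weight (x - 1) y))) = real (\<Sum>X) * tableau_density X"
proof -
  define f where "f = (\<lambda>x::nat. real x * (real x - 1))"
  define g where "g = (\<lambda>x::nat. real x * (real x + 1))"
  have inj: "inj_on f X"
  proof (rule inj_onI)
    fix x y assume x: "x \<in> X" and y: "y \<in> X" and "f x = f y"
    then have "(real x - real y) * (real x + real y - 1) = 0" by (simp add: f_def algebra_simps)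
    moreover have "real x + real y - 1 > 0" using assms(2)[OF x] assms(2)[OF y] by linarith
    ultimately show "x = y" by simp
  qed
  have "tableau_density (X - {x}) * (1 / fact (x - 1) * (\<Prod>y\<in>X - {x}. pair_weight (x - 1) y)) =
      - 1 / 2 * tableau_density X * ((\<Prod>y\<in>X. f x - g y) / (\<Prod>y\<in>X - {x}. f x - f y))" if x: "x \<in> X" for x
  proof -
    have x1: "1 \<le> x" using assms x by blast
    have "pair_weight (x - 1) y = pair_weight x y * ((f x - g y) / (f x - f y))" if y: "y \<in> X - {x}" for y
    proof -
      have y1: "1 \<le> y" "x \<noteq> y" using assms y by auto
      have fg: "f x - g y = (real x - 1 - real y) * (real x + real y)"
        "f x - f y = (real x - real y) * (real x + real y - 1)"
        by (simp_all add: f_def g_def algebra_simps)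
      \<comment> \<open>For distinct integers, \<open>x - 1 - y\<close> is 0 or has the sign of
        \<open>x - y\<close>.\<close>
      have abs: "\<bar>real x - 1 - real y\<bar> * (real x - real y) = \<bar>real x - real y\<bar> * (real x - 1 - real y)"
      proof (cases "x < y")
        case True
        then show ?thesis by (simp add: abs_if algebra_simps)
      next
        case False
        then have "real x - real y \<ge> 1" using y1 by linarith
        then show ?thesis by (simp add: abs_if)
      qed
      have pos: "real x + real y > 0" "real x + real y - 1 > 0" "real x - real y \<noteq> 0"
        using x1 y1 by auto
      have "pair_weight (x - 1) y = \<bar>real x - 1 - real y\<bar> / (real x + real y - 1)"
        using x1 by (simp add: pair_weight_def of_nat_diff algebra_simps)
      also have "\<dots> = \<bar>real x - 1 - real y\<bar> * (real x - real y) / ((real x - real y) * (real x + real y - 1))"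
        using pos by simp
      also have "\<dots> = \<bar>real x - real y\<bar> * (real x - 1 - real y) / ((real x - real y) * (real x + real y - 1))"
        by (simp only: abs)
      also have "\<dots> = pair_weight x y * ((f x - g y) / (f x - f y))"
      proof -
        have "D * e / w = D / s * (e * s / w)" if "s \<noteq> 0" for D e s w :: real
          using that by simp
        then show ?thesis unfolding fg pair_weight_def using pos(1) by (metis less_irrefl)
      qed
      finally show ?thesis .
    qed
    then have "(\<Prod>y\<in>X - {x}. pair_weight (x - 1) y) =
        (\<Prod>y\<in>X - {x}. pair_weight x y) * ((\<Prod>y\<in>X - {x}. f x - g y) / (\<Prod>y\<in>X - {x}. f x - f y))"
      by (simp add: prod.distrib prod_dividef)
    \<comment> \<open>The factor at \<open>y = x\<close> is -2 x: it absorbs the \<open>x\<close> in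
      \<open>fact x\<close>, and the constant -1 / 2 offsets the rest.\<close>
    moreover have "(\<Prod>y\<in>X. f x - g y) = - 2 * real x * (\<Prod>y\<in>X - {x}. f x - g y)"
      using prod.remove[OF assms(1) x, of "\<lambda>y. f x - g y"] by (simp add: f_def g_def algebra_simps)
    moreover have "tableau_density X = tableau_density (X - {x}) * (1 / fact x * (\<Prod>y\<in>X - {x}. pair_weight x y))"
      using tableau_density_insert[of "X - {x}" x] assms(1) x by (simp add: insert_absorb)
    moreover have "fact x = real x * fact (x - 1)" using x1 by (simp add: fact_reduce)
    moreover have "D * (1 / h * (p * (k / l))) = - 1 / 2 * (D * (1 / (z * h) * p)) * (- 2 * z * k / l)"
      if "z \<noteq> 0" for D h p k l z :: real
      using that by (cases "l = 0"; cases "h = 0"; simp add: field_simps)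
    ultimately show ?thesis using x1 by (metis of_nat_eq_0_iff not_one_le_zero)
  qed
  then have "(\<Sum>x\<in>X. tableau_density (X - {x}) *
      (1 / fact (x - 1) * (\<Prod>y\<in>X - {x}. pair_weight (x - 1) y))) =
      - 1 / 2 * tableau_density X * (sum f X - sum g X)"
    unfolding sum_quotient_products[OF assms(1) inj, symmetric] sum_distrib_left by (rule sum.cong[OF refl])
  also have "sum f X - sum g X = (\<Sum>x\<in>X. - 2 * real x)"
    by (simp add: f_def g_def algebra_simps flip: sum_subtractf)
  also have "\<dots> = - 2 * real (\<Sum>X)"
    by (simp only: sum_distrib_left of_nat_sum)
  finally show ?thesis by simp
qed

text \<open>Adding the part n + 1 multiplies the density by n! / (2 n + 1)!, by a product of pair
  weights that can be written with factorials.\<close>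

lemma tableau_density_staircase:
  "tableau_density {1..n} = (\<Prod>a = 1..n - 1. fact a) / (\<Prod>b = 1..n. fact (2 * b - 1))"
proof (induction n)
  case 0
  then show ?case by (simp add: tableau_density_def)
next
  case (Suc n)
  \<comment> \<open>Partial products up to \<open>m\<close>, so that each induction step adds the
    single factor (n - m) / (n + m + 2).\<close>
  have "(\<Prod>y=1..m. pair_weight (Suc n) y) = fact n / fact (n - m) * (fact (Suc n) / fact (Suc n + m))"
    if "m \<le> n" for m
    using that
  proof (induction m)
    case (Suc m)
    define c d where "c = real n - real m" and "d = real n + real m + 2"
    have c: "c \<noteq> 0" using Suc.prems by (simp add: c_def)
    have pw: "pair_weight (Suc n) (Suc m) = c / d"
      using Suc.prems by (simp add: pair_weight_def c_def d_def)
    have f1: "fact (n - m) = c * fact (n - Suc m)"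
      using Suc.prems by (simp add: fact_reduce[of "n - m"] of_nat_diff c_def)
    have f2: "fact (Suc n + Suc m) = d * fact (Suc n + m)"
      by (simp add: algebra_simps d_def)
    have "(\<Prod>y=1..Suc m. pair_weight (Suc n) y) = c / d * (fact n / fact (n - m) * (fact (Suc n) / fact (Suc n + m)))"
      using Suc pw by (simp add: prod.nat_ivl_Suc' mult_ac del: fact_Suc)
    also have "\<dots> = fact n / fact (n - Suc m) * (fact (Suc n) / fact (Suc n + Suc m))"
      unfolding f1 f2 using c by (simp del: fact_Suc)
    finally show ?case .
  qed simp
  from this[of n] have "(\<Prod>y=1..n. pair_weight (Suc n) y) = fact n * (fact (Suc n) / fact (2 * Suc n - 1))"
    by (simp add: mult_2 del: fact_Suc)
  moreover have "tableau_density {1..Suc n} = tableau_density {1..n} * (1 / fact (Suc n) * (\<Prod>y=1..n. pair_weight (Suc n) y))"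
    using tableau_density_insert[of "{1..n}" "Suc n"] by (simp add: atLeastAtMostSuc_conv)
  ultimately have "tableau_density {1..Suc n} = tableau_density {1..n} * (fact n / fact (2 * Suc n - 1))"
    by (simp del: fact_Suc)
  moreover have "(\<Prod>a = 1..Suc n - 1. fact a :: real) = (\<Prod>a = 1..n - 1. fact a) * fact n"
    by (cases n) (simp_all add: prod.nat_ivl_Suc' mult.commute del: fact_Suc)
  ultimately show ?case unfolding Suc by (simp add: prod.nat_ivl_Suc' mult.commute del: fact_Suc)
qed

section \<open>Counting maximal chains\<close>

lemma finite_chain_has_least:
  assumes "finite C" "C \<noteq> {}" "\<And>x y. x \<in> C \<Longrightarrow> y \<in> C \<Longrightarrow> rel x y \<or> rel y x"
    "\<And>x y z. x \<in> C \<Longrightarrow> y \<in> C \<Longrightarrow> z \<in> C \<Longrightarrow> rel x y \<Longrightarrow> rel y z \<Longrightarrow> rel x z"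
  shows "\<exists>b\<in>C. \<forall>y\<in>C. rel b y"
  using assms
proof (induction C rule: finite_ne_induct)
  case (singleton x)
  then show ?case using singleton(1)[of x x] by blast
next
  case (insert x C)
  have "\<exists>b\<in>C. \<forall>y\<in>C. rel b y"
  proof (rule insert.IH)
    show "rel y z \<or> rel z y" if "y \<in> C" "z \<in> C" for y z
      using insert.prems(1)[of y z] that by simp
    show "rel v z" if "v \<in> C" "y \<in> C" "z \<in> C" "rel v y" "rel y z" for v y z
      using insert.prems(2)[of v y z] that by simp
  qed
  then obtain b where b: "b \<in> C" "\<forall>y\<in>C. rel b y" by blast
  show ?case
  proof (cases "rel b x")
    case True
    then show ?thesis using b by auto
  next
    case False
    then have "rel x b" using insert.prems(1)[of b x] b(1) by auto
    then have "rel x y" if "y \<in> C" for y using insert.prems(2)[of x b y] b that by auto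
    moreover have "rel x x" using insert.prems(1)[of x x] by auto
    ultimately show ?thesis by auto
  qed
qed

text \<open>Removing \<open>a\<close> from a maximal chain above it leaves a maximal chain above the
  next element, a cover of \<open>a\<close>, and this can be undone. That element is the bottom of
  the rest, so different covers give disjoint families.\<close>

lemma card_maximal_chains_above:
  fixes P :: "'a set" and rel :: "'a \<Rightarrow> 'a \<Rightarrow> bool" and up :: "'a \<Rightarrow> 'a set" and cov :: "'a set"
  assumes up_def: "up = (\<lambda>x. {y \<in> P. rel x y})"
    and cov_def: "cov = {b \<in> up a - {a}. \<forall>y\<in>up a - {a}. rel y b \<longrightarrow> y = b}"
    and fin: "finite P"
    and refl: "\<And>x. x \<in> P \<Longrightarrow> rel x x"
    and antisym: "\<And>x y. x \<in> P \<Longrightarrow> y \<in> P \<Longrightarrow> rel x y \<Longrightarrow> rel y x \<Longrightarrow> x = y"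
    and trans: "\<And>x y z. x \<in> P \<Longrightarrow> y \<in> P \<Longrightarrow> z \<in> P \<Longrightarrow> rel x y \<Longrightarrow> rel y z \<Longrightarrow> rel x z"
    and a: "a \<in> P" and not_max: "up a \<noteq> {a}"
  shows "card (maximal_chains (up a) rel) = (\<Sum>b\<in>cov. card (maximal_chains (up b) rel))"
proof -
  define MC where "MC = (\<lambda>x. maximal_chains (up x) rel)"
  have chain_iff: "C \<in> order_complex (up x) rel \<longleftrightarrow> C \<subseteq> up x \<and> (\<forall>y\<in>C. \<forall>z\<in>C. rel y z \<or> rel z y)" for C x
    using finite_subset[OF _ fin, of C] by (auto simp: order_complex_def up_def)
  have MC_chain: "C \<in> order_complex (up x) rel" if "C \<in> MC x" for C x
    using that by (simp add: MC_def maximal_chains_def)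
  have MC_max: "D = C" if "C \<in> MC x" "D \<in> order_complex (up x) rel" "C \<subseteq> D" for C D x
    using that by (simp add: MC_def maximal_chains_def)
  have MCI: "C \<in> MC x" if "C \<in> order_complex (up x) rel"
    "\<And>D. D \<in> order_complex (up x) rel \<Longrightarrow> C \<subseteq> D \<Longrightarrow> D = C" for C x
    using that by (simp add: MC_def maximal_chains_def)
  have insert_chain: "insert x C \<in> order_complex (up x) rel" if "x \<in> P" "C \<in> order_complex (up x) rel" for x C
    using that refl unfolding chain_iff unfolding up_def by auto
  have bottom: "x \<in> C" if "C \<in> MC x" "x \<in> P" for x C
    using MC_max[OF that(1) insert_chain[OF that(2) MC_chain[OF that(1)]]] by blast
  have up_P: "up x \<subseteq> P" for x by (auto simp: up_def)
  have cov: "b \<in> P" "rel a b" "b \<noteq> a" "\<And>y. y \<in> P \<Longrightarrow> rel a y \<Longrightarrow> y \<noteq> a \<Longrightarrow> rel y b \<Longrightarrow> y = b"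
    if "b \<in> cov" for b
    using that by (auto simp: cov_def up_def)
  have a_notin: "a \<notin> up b" if "b \<in> cov" for b
    using cov(1-3)[OF that] antisym[OF a, of b] by (auto simp: up_def)
  have up_sub: "up b \<subseteq> up a" if "b \<in> cov" for b
  proof
    fix y assume "y \<in> up b"
    then show "y \<in> up a" using trans[OF a, of b y] cov(1,2)[OF that] by (simp add: up_def)
  qed
  have MC_a: "MC a = (\<Union>b\<in>cov. insert a ` MC b)"
  proof (intro subset_antisym subsetI)
    fix C assume C: "C \<in> MC a"
    note Cc = MC_chain[OF C, unfolded chain_iff]
    have "C \<noteq> {a}"
    proof
      assume "C = {a}"
      obtain x where x: "x \<in> up a" "x \<noteq> a" using not_max refl a by (auto simp: up_def)
      have "{a, x} \<in> order_complex (up a) rel"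
        using x refl a unfolding chain_iff unfolding up_def by auto
      then show False using MC_max[OF C, of "{a, x}"] \<open>C = {a}\<close> x by auto
    qed
    then have ne: "C - {a} \<noteq> {}" using bottom[OF C a] by auto
    have CP: "C \<subseteq> P" using Cc up_P by blast
    have "\<exists>b\<in>C - {a}. \<forall>y\<in>C - {a}. rel b y"
    proof (rule finite_chain_has_least[OF _ ne])
      show "finite (C - {a})" using CP fin finite_subset by blast
      show "rel x y \<or> rel y x" if "x \<in> C - {a}" "y \<in> C - {a}" for x y using Cc that by blast
      show "rel x z" if "x \<in> C - {a}" "y \<in> C - {a}" "z \<in> C - {a}" "rel x y" "rel y z" for x y z
        using trans[of x y z] that CP by blast
    qed
    then obtain b where b: "b \<in> C" "b \<noteq> a" "\<And>y. y \<in> C \<Longrightarrow> y \<noteq> a \<Longrightarrow> rel b y" by blast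
    have bP: "b \<in> P" "rel a b" using Cc b(1) by (auto simp: up_def)
    \<comment> \<open>An element between \<open>a\<close> and \<open>b\<close> could be inserted
      into the chain, so maximality puts it there already.\<close>
    have "y = b" if y: "y \<in> P" "rel a y" "y \<noteq> a" "rel y b" for y
    proof -
      have "rel y z" if "z \<in> C" "z \<noteq> a" for z
        using trans[of y b z] y bP b(3)[OF that] that CP by blast
      moreover have "rel a z" if "z \<in> C" for z using Cc that by (auto simp: up_def)
      ultimately have "insert y C \<in> order_complex (up a) rel"
        using Cc y refl unfolding chain_iff unfolding up_def by blast
      then have "y \<in> C" using MC_max[OF C] by blast
      then show ?thesis using b(3) y antisym bP by blast
    qed
    then have "b \<in> cov" using bP b(2) by (auto simp: cov_def up_def)
    moreover have "C - {a} \<in> MC b"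
    proof (rule MCI)
      show "C - {a} \<in> order_complex (up b) rel"
        using Cc b(3) CP unfolding chain_iff unfolding up_def by blast
      fix D assume D: "D \<in> order_complex (up b) rel" "C - {a} \<subseteq> D"
      then have "insert a D \<in> order_complex (up a) rel"
        using up_sub[OF \<open>b \<in> cov\<close>] a refl unfolding chain_iff unfolding up_def by blast
      moreover have "C \<subseteq> insert a D" using D(2) by blast
      ultimately have "insert a D = C" using MC_max[OF C] by blast
      moreover have "a \<notin> D" using D(1) a_notin[OF \<open>b \<in> cov\<close>] unfolding chain_iff by blast
      ultimately show "D = C - {a}" by blast
    qed
    moreover have "C = insert a (C - {a})" using bottom[OF C a] by blast
    ultimately show "C \<in> (\<Union>b\<in>cov. insert a ` MC b)" by blast
  next
    fix C assume "C \<in> (\<Union>b\<in>cov. insert a ` MC b)"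
    then obtain b D where b: "b \<in> cov" and D: "D \<in> MC b" and C: "C = insert a D" by blast
    note Dc = MC_chain[OF D, unfolded chain_iff]
    have bD: "b \<in> D" using bottom[OF D cov(1)[OF b]] .
    show "C \<in> MC a"
    proof (rule MCI)
      show "C \<in> order_complex (up a) rel"
        using Dc up_sub[OF b] a refl unfolding C chain_iff unfolding up_def by blast
      fix G assume G: "G \<in> order_complex (up a) rel" "C \<subseteq> G"
      \<comment> \<open>An element of \<open>G\<close> below the cover \<open>b\<close> and
        different from \<open>a\<close> can only be \<open>b\<close>.\<close>
      have "rel b y" if "y \<in> G" "y \<noteq> a" for y
      proof -
        have "rel b y \<or> rel y b" "y \<in> P" "rel a y"
          using G that bD unfolding C chain_iff unfolding up_def by blast+
        then show ?thesis using cov[OF b] refl that(2) by metis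
      qed
      then have "G - {a} \<in> order_complex (up b) rel"
        using G(1) unfolding chain_iff unfolding up_def by blast
      moreover have "D \<subseteq> G - {a}" using G(2) Dc a_notin[OF b] unfolding C by blast
      ultimately have "G - {a} = D" using MC_max[OF D] by blast
      then show "G = C" using G(2) unfolding C by blast
    qed
  qed
  have not_in: "a \<notin> D" if "b \<in> cov" "D \<in> MC b" for b D
    using MC_chain[OF that(2)] a_notin[OF that(1)] unfolding chain_iff by blast
  have finMC: "finite (MC x)" for x
    by (rule finite_subset[of _ "Pow P"]) (use fin up_P MC_chain chain_iff in blast)+
  have "finite cov" using fin by (simp add: cov_def up_def)
  \<comment> \<open>Equal chains contain both bottoms \<open>b\<close> and \<open>b'\<close>, each
    of which then lies above the other.\<close>
  have "b = b'" if bb: "b \<in> cov" "b' \<in> cov" and D: "D \<in> MC b" "D' \<in> MC b'" "insert a D = insert a D'" for b b' D D'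
  proof -
    have "D = D'"
      using D(3) not_in[OF bb(1) D(1)] not_in[OF bb(2) D(2)] by (simp add: insert_ident)
    then have "b \<in> up b'" "b' \<in> up b"
      using bottom D cov(1) bb MC_chain unfolding chain_iff by blast+
    then show ?thesis using antisym by (auto simp: up_def)
  qed
  then have "card (MC a) = (\<Sum>b\<in>cov. card (insert a ` MC b))"
    unfolding MC_a using \<open>finite cov\<close> finMC by (intro card_UN_disjoint) blast+
  also have "\<dots> = (\<Sum>b\<in>cov. card (MC b))"
  proof (rule sum.cong[OF HOL.refl])
    fix b assume b: "b \<in> cov"
    have "inj_on (insert a) (MC b)"
    proof (rule inj_onI)
      fix D D' assume "D \<in> MC b" "D' \<in> MC b" "insert a D = insert a D'"
      then show "D = D'" using not_in[OF b, of D] not_in[OF b, of D'] by (simp add: insert_ident)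
    qed
    then show "card (insert a ` MC b) = card (MC b)" by (rule card_image)
  qed
  finally show ?thesis by (simp add: MC_def)
qed

text \<open>The number of filled boxes, \<open>(n, 1)\<close> included; it drops by one along each
  cover.\<close>

definition tab_size :: "nat \<Rightarrow> nat set \<Rightarrow> nat" where
  "tab_size n A = (\<Sum>t = 1..n. cnt A t)"

text \<open>Reflecting the alphabet turns the tableau order into reverse inclusion of strict partitions.\<close>

definition parts :: "nat \<Rightarrow> nat set \<Rightarrow> nat set" where
  "parts n A = (\<lambda>a. n + 1 - a) ` A"

text \<open>On \<open>parts\<close> this takes one box from the part \<open>n + 1 - a\<close>; the
  case \<open>a = n\<close> is the part 1 disappearing.\<close>

definition raise :: "nat \<Rightarrow> nat set \<Rightarrow> nat \<Rightarrow> nat set" where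
  "raise n A a = (if a < n then insert (Suc a) (A - {a}) else A - {a})"

section \<open>Removing one box\<close>

lemma T_bounds: "A \<in> T n \<Longrightarrow> a \<in> A \<Longrightarrow> 1 \<le> a \<and> a \<le> n"
  by (auto simp: T_def)

lemma inj_on_reflect: "A \<in> T n \<Longrightarrow> inj_on (\<lambda>a. n + 1 - a) A"
proof (rule inj_onI)
  fix x y assume "A \<in> T n" "x \<in> A" "y \<in> A" "n + 1 - x = n + 1 - y"
  then show "x = y" using T_bounds[of A n x] T_bounds[of A n y] by linarith
qed

lemma parts_pos: "A \<in> T n \<Longrightarrow> x \<in> parts n A \<Longrightarrow> 1 \<le> x"
  using T_bounds by (fastforce simp: parts_def)

text \<open>Double counting: \<open>cnt A t\<close> counts the entry \<open>a\<close> for the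
  \<open>n + 1 - a\<close> values of \<open>t\<close> from \<open>a\<close> to
  \<open>n\<close>.\<close>

lemma tab_size_eq_sum_parts: "A \<in> T n \<Longrightarrow> tab_size n A = \<Sum>(parts n A)"
proof -
  assume A: "A \<in> T n"
  have "tab_size n A = (\<Sum>t = 1..n. \<Sum>a\<in>A. if a \<le> t then 1 else 0)"
    unfolding tab_size_def cnt_def using T_finite[OF A] by (simp add: sum.If_cases Collect_conj_eq)
  also have "\<dots> = (\<Sum>a\<in>A. \<Sum>t = 1..n. if a \<le> t then 1 else 0)"
    by (rule sum.swap)
  also have "\<dots> = (\<Sum>a\<in>A. n + 1 - a)"
  proof (rule sum.cong[OF HOL.refl])
    fix a assume "a \<in> A"
    then have "{1..n} \<inter> {t. a \<le> t} = {a..n}" using A by (auto simp: T_def)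
    then show "(\<Sum>t = 1..n. if a \<le> t then 1 else 0) = n + 1 - a" by (simp add: sum.If_cases)
  qed
  finally show ?thesis
    unfolding parts_def using inj_on_reflect[OF A] by (simp add: sum.reindex)
qed

text \<open>Moving \<open>a\<close> to \<open>a + 1\<close>, or out of the alphabet, affects the
  count at \<open>a\<close> alone. \<open>{n}\<close> is excluded because raising its entry would
  leave the empty set.\<close>

lemma
  assumes A: "A \<in> T n" "A \<noteq> {n}" and a: "a \<in> A" "Suc a \<notin> A"
  shows raise_in_T: "raise n A a \<in> T n"
    and cnt_raise: "t \<le> n \<Longrightarrow> cnt (raise n A a) t + (if t = a then 1 else 0) = cnt A t"
proof -
  have an: "1 \<le> a" "a \<le> n" using A(1) a(1) by (auto simp: T_def)
  have "A - {a} \<noteq> {}" if "a = n" using A a(1) that by (auto simp: T_def)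
  then show R: "raise n A a \<in> T n"
    using A an by (auto simp: T_def raise_def)
  show "t \<le> n \<Longrightarrow> cnt (raise n A a) t + (if t = a then 1 else 0) = cnt A t"
  proof (induction t)
    case 0
    then show ?case using an by (simp add: cnt_0[OF A(1)] cnt_0[OF R])
  next
    case (Suc t)
    then show ?case
      using a unfolding cnt_Suc[OF A(1)] cnt_Suc[OF R] by (auto simp: raise_def split: if_splits)
  qed
qed

lemma tab_size_raise:
  assumes A: "A \<in> T n" "A \<noteq> {n}" and a: "a \<in> A" "Suc a \<notin> A"
  shows "tab_size n (raise n A a) + 1 = tab_size n A"
proof -
  have "a \<in> {1..n}" using A(1) a(1) by (auto simp: T_def)
  then have "tab_size n (raise n A a) + 1 = (\<Sum>t = 1..n. cnt (raise n A a) t + (if t = a then 1 else 0))"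
    by (simp add: tab_size_def sum.distrib)
  also have "\<dots> = tab_size n A"
    unfolding tab_size_def using cnt_raise[OF assms] by (intro sum.cong) auto
  finally show ?thesis .
qed

section \<open>Rank and covers of the tableau order\<close>

lemma tab_le_refl: "A \<in> T n \<Longrightarrow> tab_le n A A"
  by (simp add: tab_le_iff)

lemma tab_le_antisym: "A \<in> T n \<Longrightarrow> B \<in> T n \<Longrightarrow> tab_le n A B \<Longrightarrow> tab_le n B A \<Longrightarrow> A = B"
  by (rule cnt_inject[of A n B]) (auto simp: tab_le_iff intro: order_antisym)

lemma tab_le_trans:
  "A \<in> T n \<Longrightarrow> B \<in> T n \<Longrightarrow> C \<in> T n \<Longrightarrow> tab_le n A B \<Longrightarrow> tab_le n B C \<Longrightarrow> tab_le n A C"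
  by (simp add: tab_le_iff) (meson le_trans)

lemma tab_size_mono:
  assumes "A \<in> T n" "B \<in> T n" "tab_le n A B"
  shows "tab_size n B \<le> tab_size n A"
  unfolding tab_size_def using assms by (intro sum_mono) (simp add: tab_le_iff)

lemma tab_size_eq_imp_eq:
  assumes "A \<in> T n" "B \<in> T n" "tab_le n A B" "tab_size n A = tab_size n B"
  shows "A = B"
proof (rule ccontr)
  assume "A \<noteq> B"
  then obtain t where tn: "t \<le> n" "cnt A t \<noteq> cnt B t" using cnt_inject[OF assms(1,2)] by blast
  then have "t \<noteq> 0" using cnt_0[OF assms(1)] cnt_0[OF assms(2)] by metis
  moreover have "cnt B t \<le> cnt A t" using assms(3) tn(1) tab_le_iff[OF assms(1,2)] by blast
  ultimately have t: "t \<in> {1..n}" "cnt B t < cnt A t" using tn by simp_all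
  have "tab_size n B < tab_size n A"
    unfolding tab_size_def using assms t by (intro sum_strict_mono_ex1) (auto simp: tab_le_iff)
  then show False using assms(4) by simp
qed

lemma raise_above:
  assumes A: "A \<in> T n" "A \<noteq> {n}" and a: "a \<in> A" "Suc a \<notin> A"
  shows "tab_le n A (raise n A a)" "raise n A a \<noteq> A"
proof -
  show "tab_le n A (raise n A a)"
    unfolding tab_le_iff[OF A(1) raise_in_T[OF assms]]
    using cnt_raise[OF assms] by (metis le_add1)
  show "raise n A a \<noteq> A" using a by (auto simp: raise_def)
qed

text \<open>An entry can be raised where the count of \<open>A\<close> has a surplus over that of
  \<open>B\<close>. The last such entry \<open>a\<close> works: an entry \<open>a + 1\<close> would
  inherit the surplus, as the count of \<open>B\<close> grows by at most one.\<close>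

lemma ex_raise_below:
  assumes A: "A \<in> T n" and B: "B \<in> T n" and le: "tab_le n A B" and ne: "A \<noteq> B"
  obtains a where "a \<in> A" "Suc a \<notin> A" "A \<noteq> {n}" "tab_le n (raise n A a) B"
proof -
  define D where "D = {t. t \<le> n \<and> cnt B t < cnt A t}"
  have le': "cnt B t \<le> cnt A t" if "t \<le> n" for t using le that by (simp add: tab_le_iff A B)
  obtain t0 where "t0 \<in> D" using cnt_inject[OF A B] ne le' by (force simp: D_def less_le)
  define t where "t = (LEAST t. t \<in> D)"
  have t: "t \<in> D" "\<And>s. s < t \<Longrightarrow> s \<notin> D"
    unfolding t_def using \<open>t0 \<in> D\<close> by (auto intro: LeastI dest: not_less_Least)
  \<comment> \<open>Just before the first surplus the counts agree, so \<open>A\<close> must jump at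
    \<open>t\<close>.\<close>
  have "t \<in> A"
  proof (cases t)
    case 0
    then show ?thesis using t(1) by (simp add: D_def cnt_0[OF A])
  next
    case (Suc s)
    have "s \<notin> D" using t(2)[of s] Suc by simp
    then have "cnt A s = cnt B s" using le'[of s] t(1) Suc by (auto simp: D_def)
    then show ?thesis
      using t(1) Suc cnt_Suc[OF A, of s] cnt_Suc[OF B, of s] by (auto simp: D_def split: if_splits)
  qed
  define a where "a = Max (A \<inter> D)"
  have fin: "finite (A \<inter> D)" using T_finite[OF A] by simp
  then have a: "a \<in> A" "a \<in> D" unfolding a_def using Max_in[of "A \<inter> D"] t(1) \<open>t \<in> A\<close> by blast+
  have "Suc a \<notin> A"
  proof
    assume "Suc a \<in> A"
    moreover from this have "Suc a \<in> D"
      using a(2) A cnt_Suc[OF A, of a] cnt_Suc[OF B, of a] by (auto simp: D_def T_def)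
    ultimately have "Suc a \<le> a" unfolding a_def using fin by (intro Max_ge) auto
    then show False by simp
  qed
  have "A \<noteq> {n}"
  proof
    assume "A = {n}"
    then have "a = n" using a by simp
    then have "cnt B n = 0" using a(2) cnt_n[OF A] \<open>A = {n}\<close> by (simp add: D_def)
    then show False using cnt_n_pos[OF B] by simp
  qed
  note r = A \<open>A \<noteq> {n}\<close> a(1) \<open>Suc a \<notin> A\<close>
  have "cnt B t \<le> cnt (raise n A a) t" if "t \<le> n" for t
    using cnt_raise[OF r that] le'[OF that] a(2) by (auto simp: D_def split: if_splits)
  then have "tab_le n (raise n A a) B" using tab_le_iff[OF raise_in_T[OF r] B] by blast
  then show ?thesis using that r by blast
qed

text \<open>The right-hand side has the form of a summand of
  \<open>tableau_density_recursion\<close>.\<close>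

lemma tableau_density_raise:
  assumes A: "A \<in> T n" and a: "a \<in> A" "Suc a \<notin> A"
  shows "tableau_density (parts n (raise n A a)) = tableau_density (parts n A - {n + 1 - a}) *
    (1 / fact (n + 1 - a - 1) * (\<Prod>y\<in>parts n A - {n + 1 - a}. pair_weight (n + 1 - a - 1) y))"
proof -
  have an: "1 \<le> a" "a \<le> n" using A a(1) by (auto simp: T_def)
  have fin: "finite (parts n A)" using T_finite[OF A] by (simp add: parts_def)
  have del: "parts n A - {n + 1 - a} = parts n (A - {a})"
    unfolding parts_def using inj_on_reflect[OF A] a(1) by (subst inj_on_image_set_diff[of _ A]) auto
  show ?thesis
  proof (cases "a < n")
    case True
    have "n - a \<notin> parts n (A - {a})"
    proof
      assume "n - a \<in> parts n (A - {a})"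
      then obtain c where c: "c \<in> A" "n - a = n + 1 - c" by (auto simp: parts_def)
      then have "c = Suc a" using A True by (auto simp: T_def)
      then show False using c a(2) by simp
    qed
    moreover have "parts n (raise n A a) = insert (n - a) (parts n (A - {a}))"
      using True by (simp add: raise_def parts_def)
    ultimately show ?thesis
      using tableau_density_insert[of "parts n (A - {a})" "n - a"] fin unfolding del
      by (simp add: parts_def T_finite[OF A])
  next
    case False
    then have "a = n" using an by simp
    \<comment> \<open>The part 1 shrinks to 0, and pair weights of 0 with positive parts are 1, so
      the summand describes plain deletion.\<close>
    have "(\<Prod>y\<in>parts n (A - {n}). pair_weight 0 y) = 1"
      using A by (intro prod.neutral) (auto simp: parts_def pair_weight_def T_def)
    then show ?thesis unfolding del using \<open>a = n\<close> by (simp add: raise_def)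
  qed
qed

lemma sum_tableau_density_raise:
  assumes A: "A \<in> T n"
  shows "(\<Sum>a | a \<in> A \<and> Suc a \<notin> A. tableau_density (parts n (raise n A a))) =
    real (tab_size n A) * tableau_density (parts n A)"
proof -
  define X where "X = parts n A"
  define h where "h = (\<lambda>x. tableau_density (X - {x}) * (1 / fact (x - 1) * (\<Prod>y\<in>X - {x}. pair_weight (x - 1) y)))"
  have fin: "finite X" using T_finite[OF A] by (simp add: X_def parts_def)
  have "(\<Sum>a | a \<in> A \<and> Suc a \<notin> A. tableau_density (parts n (raise n A a))) =
      (\<Sum>a | a \<in> A \<and> Suc a \<notin> A. h (n + 1 - a))"
    using tableau_density_raise[OF A] by (intro sum.cong) (auto simp: h_def X_def)
  also have "\<dots> = (\<Sum>a\<in>A. h (n + 1 - a))"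
  \<comment> \<open>The sum extends to all entries: if \<open>a + 1\<close> is in \<open>A\<close>,
    the shrunken part repeats another one and their pair weight is 0.\<close>
  proof (rule sum.mono_neutral_left[OF T_finite[OF A]])
    show "\<forall>a\<in>A - {a. a \<in> A \<and> Suc a \<notin> A}. h (n + 1 - a) = 0"
    proof
      fix a assume "a \<in> A - {a. a \<in> A \<and> Suc a \<notin> A}"
      then have a: "a \<in> A" "Suc a \<in> A" by auto
      then have "Suc a \<le> n" using A by (auto simp: T_def)
      then have "n + 1 - a - 1 \<in> X - {n + 1 - a}"
        using a(2) by (auto simp: X_def parts_def image_iff intro!: bexI[of _ "Suc a"])
      moreover have "pair_weight (n + 1 - a - 1) (n + 1 - a - 1) = 0" by (simp add: pair_weight_def)
      ultimately have "(\<Prod>y\<in>X - {n + 1 - a}. pair_weight (n + 1 - a - 1) y) = 0"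
        using fin by (intro prod_zero) blast+
      then show "h (n + 1 - a) = 0" by (simp add: h_def)
    qed
  qed auto
  also have "\<dots> = (\<Sum>x\<in>X. h x)"
    unfolding X_def parts_def using inj_on_reflect[OF A] by (simp add: sum.reindex)
  also have "\<dots> = real (\<Sum>X) * tableau_density X"
    unfolding h_def using fin parts_pos[OF A] by (intro tableau_density_recursion) (simp_all add: X_def)
  finally show ?thesis using tab_size_eq_sum_parts[OF A] by (simp add: X_def)
qed

text \<open>The covers of \<open>A\<close> are its raised sets, each smaller by one box, so both
  sides satisfy the same recursion; it ends at \<open>{n}\<close>, the greatest element.\<close>

lemma card_maximal_chains_tab:
  assumes "A \<in> T n"
  shows "real (card (maximal_chains {B \<in> T n. tab_le n A B} (tab_le n))) =
    fact (tab_size n A) * tableau_density (parts n A)"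
  using assms
proof (induction "tab_size n A" arbitrary: A rule: less_induct)
  case less
  note A = less.prems
  have finT: "finite (T n)" by (rule finite_subset[of _ "Pow {1..n}"]) (auto simp: T_def)
  define up where "up = (\<lambda>A. {B \<in> T n. tab_le n A B})"
  show ?case
  proof (cases "A = {n}")
    case True
    have "B = A" if "B \<in> up A" for B
      using that ex_raise_below[OF A, of B] True by (auto simp: up_def)
    then have up: "up A = {A}" using tab_le_refl[OF A] A by (auto simp: up_def)
    have "order_complex {A} (tab_le n) = {{}, {A}}"
      using tab_le_refl[OF A] by (auto simp: order_complex_def)
    then have "maximal_chains (up A) (tab_le n) = {{A}}"
      unfolding up maximal_chains_def by auto
    moreover have "1 \<le> n" using A True by (auto simp: T_def)
    then have "parts n A = {1}" using True by (simp add: parts_def)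
    moreover from this have "tab_size n A = 1" using tab_size_eq_sum_parts[OF A] by simp
    moreover have "tableau_density {1} = 1"
      using tableau_density_insert[of "{}" 1] by (simp add: tableau_density_def)
    ultimately show ?thesis by (simp add: up_def)
  next
    case False
    define R where "R = {a. a \<in> A \<and> Suc a \<notin> A}"
    have R: "raise n A a \<in> up A - {A}" if "a \<in> R" for a
      using that raise_in_T[OF A False] raise_above[OF A False] by (auto simp: R_def up_def)
    have size: "tab_size n (raise n A a) + 1 = tab_size n A" if "a \<in> R" for a
      using that tab_size_raise[OF A False] by (auto simp: R_def)
    have below: "\<exists>a\<in>R. tab_le n (raise n A a) B" if B: "B \<in> up A - {A}" for B
    proof -
      have "B \<in> T n" "tab_le n A B" "A \<noteq> B" using B by (auto simp: up_def)
      from ex_raise_below[OF A this] obtain a where "a \<in> A" "Suc a \<notin> A" "tab_le n (raise n A a) B"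
        by blast
      then show ?thesis by (auto simp: R_def)
    qed
    have size_less: "tab_size n B < tab_size n A" if "B \<in> up A - {A}" for B
      using that tab_size_mono[OF A, of B] tab_size_eq_imp_eq[OF A, of B]
      by (auto simp: up_def less_le)
    have cov: "{B \<in> up A - {A}. \<forall>C\<in>up A - {A}. tab_le n C B \<longrightarrow> C = B} = raise n A ` R" (is "?cov = _")
    proof (intro subset_antisym subsetI)
      fix B assume B: "B \<in> ?cov"
      then obtain a where a: "a \<in> R" "tab_le n (raise n A a) B" using below[of B] by blast
      then have "raise n A a = B" using B R[OF a(1)] by blast
      then show "B \<in> raise n A ` R" using a(1) by blast
    next
      fix B assume "B \<in> raise n A ` R"
      then obtain a where a: "a \<in> R" "B = raise n A a" by blast
      \<comment> \<open>Lying strictly above \<open>A\<close>, \<open>C\<close> has at most the size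
        of \<open>B\<close>; lying below \<open>B\<close>, it has at least that size.\<close>
      have "C = B" if C: "C \<in> up A - {A}" "tab_le n C B" for C
      proof -
        have CT: "C \<in> T n" "B \<in> T n" using C R[OF a(1)] a(2) by (auto simp: up_def)
        have "tab_size n B \<le> tab_size n C" using tab_size_mono[OF CT C(2)] .
        moreover have "tab_size n C < tab_size n B + 1" using size_less[OF C(1)] size[OF a(1)] a(2) by simp
        ultimately show ?thesis using tab_size_eq_imp_eq[OF CT C(2)] by simp
      qed
      then show "B \<in> ?cov" using R[OF a(1)] a(2) by blast
    qed
    \<comment> \<open>The entry \<open>a\<close> is recovered as the only place where the count
      drops.\<close>
    have inj: "inj_on (raise n A) R"
    proof (rule inj_onI, rule ccontr)
      fix a b assume ab: "a \<in> R" "b \<in> R" "raise n A a = raise n A b" "a \<noteq> b"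
      then have "a \<le> n" using A by (auto simp: R_def T_def)
      then show False
        using cnt_raise[OF A False, of a a] cnt_raise[OF A False, of b a] ab by (simp add: R_def)
    qed
    have "R \<noteq> {}"
    proof -
      have "Max A \<in> A" using A T_finite[OF A] by (intro Max_in) (auto simp: T_def)
      moreover have "Suc (Max A) \<notin> A" using Max_ge[OF T_finite[OF A], of "Suc (Max A)"] by auto
      ultimately show ?thesis by (auto simp: R_def)
    qed
    then have "up A \<noteq> {A}" using R by blast
    then have "card (maximal_chains (up A) (tab_le n)) =
        (\<Sum>B\<in>raise n A ` R. card (maximal_chains (up B) (tab_le n)))"
      using card_maximal_chains_above[OF up_def cov[symmetric] finT tab_le_refl tab_le_antisym tab_le_trans A]
      by simp
    also have "\<dots> = (\<Sum>a\<in>R. card (maximal_chains (up (raise n A a)) (tab_le n)))"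
      using inj by (simp add: sum.reindex)
    finally have "real (card (maximal_chains (up A) (tab_le n))) =
        (\<Sum>a\<in>R. real (card (maximal_chains (up (raise n A a)) (tab_le n))))" by simp
    also have "\<dots> = (\<Sum>a\<in>R. fact (tab_size n A - 1) * tableau_density (parts n (raise n A a)))"
    proof (rule sum.cong[OF HOL.refl])
      fix a assume a: "a \<in> R"
      have "tab_size n (raise n A a) = tab_size n A - 1" using size[OF a] by simp
      then show "real (card (maximal_chains (up (raise n A a)) (tab_le n))) =
          fact (tab_size n A - 1) * tableau_density (parts n (raise n A a))"
        using less.hyps[of "raise n A a"] size[OF a] R[OF a] by (simp add: up_def)
    qed
    also have "\<dots> = fact (tab_size n A - 1) * (real (tab_size n A) * tableau_density (parts n A))"
      using sum_tableau_density_raise[OF A] by (simp add: R_def flip: sum_distrib_left)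
    also have "\<dots> = fact (tab_size n A) * tableau_density (parts n A)"
    proof -
      obtain a where "a \<in> R" using \<open>R \<noteq> {}\<close> by blast
      then have "tab_size n A > 0" using size[of a] by simp
      then show ?thesis by (simp add: fact_reduce[of "tab_size n A"])
    qed
    finally show ?thesis by (simp add: up_def)
  qed
qed

text \<open>\<open>{1..n}\<close> is the least element of the poset, and reflection maps it to
  itself.\<close>

lemma card_maximal_chains_T:
  assumes "n \<ge> 1"
  shows "real (card (maximal_chains (T n) (tab_le n))) =
    fact ((n + 1) choose 2) * (\<Prod>a = 1..n - 1. fact a) / (\<Prod>b = 1..n. fact (2 * b - 1))"
proof -
  have A: "{1..n} \<in> T n" using assms by (auto simp: T_def)
  have cnt: "cnt {1..n} t = t" if "t \<le> n" for t
  proof -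
    have "{a \<in> {1..n}. a \<le> t} = {1..t}" using that by auto
    then show ?thesis by (simp add: cnt_def)
  qed
  have "tab_le n {1..n} B" if "B \<in> T n" for B
    unfolding tab_le_iff[OF A that] using cnt cnt_le[OF that] by simp
  then have "{B \<in> T n. tab_le n {1..n} B} = T n" by auto
  moreover have "tab_size n {1..n} = (\<Sum>t = 1..n. t)"
    unfolding tab_size_def using cnt by (intro sum.cong) auto
  moreover have "(\<Sum>t = 1..n. t) = (n + 1) choose 2"
    by (induction n) (simp_all add: numeral_2_eq_2)
  moreover have "parts n {1..n} = {1..n}"
  proof
    show "{1..n} \<subseteq> parts n {1..n}"
    proof
      fix x assume "x \<in> {1..n}"
      then show "x \<in> parts n {1..n}"
        unfolding parts_def by (intro image_eqI[of _ _ "n + 1 - x"]) auto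
    qed
  qed (auto simp: parts_def)
  ultimately show ?thesis
    using card_maximal_chains_tab[OF A] tableau_density_staircase[of n] by simp
qed

theorem mainTheorem9:
  fixes n :: nat
  assumes "n \<ge> 1"
  shows "cohen_macaulay_Z (order_complex (T n) (tab_le n))
    \<and> realization (order_complex (T n) (tab_le n))
        homeomorphic_space closed_ball_space ((n + 1 choose 2) - 1)
    \<and> real (card (maximal_chains (T n) (tab_le n))) =
        fact ((n + 1) choose 2) * (\<Prod>a = 1..n - 1. fact a)
          / (\<Prod>b = 1..n. fact (2 * b - 1))"
proof (intro conjI)
  \<comment> \<open>The rank grows by one along both kinds of edges; adding \<open>n\<close>
    prevents truncated subtraction, since \<open>t \<le> n\<close>.\<close>
  interpret ideal_labelling "staircase n" "staircase_edges n" "\<lambda>(t, k). n + 2 * k - t"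
    "T n" "tab_le n" "staircase_ideal n"
  proof
    show "finite (staircase n)" using card_staircase assms by blast
    show "staircase_edges n \<subseteq> staircase n \<times> staircase n"
      by (auto simp: staircase_edges_def)
    show "(case p of (t, k) \<Rightarrow> n + 2 * k - t) < (case q of (t, k) \<Rightarrow> n + 2 * k - t)"
      if "(p, q) \<in> staircase_edges n" for p q
      using that by (auto simp: staircase_edges_def staircase_def)
    show "tab_le n A B \<longleftrightarrow> staircase_ideal n B \<subseteq> staircase_ideal n A" if "A \<in> T n" "B \<in> T n" for A B
      using that by (simp add: tab_le_iff staircase_ideal_subset_iff)
  qed (rule bij_betw_staircase_ideal[OF assms])
  show "cohen_macaulay_Z (order_complex (T n) (tab_le n))"
    by (rule cohen_macaulay)
  show "realization (order_complex (T n) (tab_le n)) homeomorphic_space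
      closed_ball_space ((n + 1 choose 2) - 1)"
    using realization_homeomorphic_ball card_staircase(2)[OF assms] by simp
  show "real (card (maximal_chains (T n) (tab_le n))) =
      fact ((n + 1) choose 2) * (\<Prod>a = 1..n - 1. fact a) / (\<Prod>b = 1..n. fact (2 * b - 1))"
    using assms by (rule card_maximal_chains_T)
qed

end
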